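(* Let $1\le p_0<q_0\le\infty$, let $T$ be a sublinear operator bounded on $L^{p_0}(\mathbb{R}^n)$, and let $\{A_r\}_{r>0}$ be a family of operators from $L^\infty_c(\mathbb{R}^n)$ into $L^{p_0}(\mathbb{R}^n)$. Let $c_0\ge1$ be a fixed constant depending only on $n$. Assume that for every $\theta>0$ there is $C_\theta$ such that for all $f\in L^\infty_c$ and all $x\in\mathbb{R}^n$, $$\sup_{B=B(x_0,r)\ni x,\ r<\rho(x_0)}\frac{1}{|c_0B|}\int_{c_0B}|T(I-A_{c_0r})f(y)|^{p_0}dy+\sup_{B=B(x_0,r)\ni x,\ r\ge\rho(x_0)}\frac{1}{\Psi_\theta(B)|B|}\int_B|Tf(y)|^{p_0}dy\le C_\theta M_{\rho,\theta}(|f|^{p_0})(x),$$ and, for every ball $B=B(x_0,r)$ with $r<\rho(x_0)$ and every $x\in c_0B$, $$\Big(\frac{1}{|c_0B|}\int_{c_0B}|TA_{c_0r}f(y)|^{q_0}dy\Big)^{1/q_0}\le C_\theta M_{\rho,\theta}(|f|^{p_0})(x)^{1/p_0}$$ (essential supremum if $q_0=\infty$). Let $p_0<p<q_0$ (or $p=q_0$ when $q_0<\infty$) and $\omega\in A_{p/p_0}^{\rho,\infty}\cap RH_{(q_0/p)'}^{loc}$. Then there is $C$ such that $\|Tf\|_{L^p(\omega)}\le C\|f\|_{L^p(\omega)}$ for all $f\in L^\infty_c(\mathbb{R}^n)$.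
   Context: $\rho:\mathbb{R}^n\to(0,\infty)$ satisfies, for constants $l_0>0$, $C_0>1$: $C_0^{-1}(1+|x-y|/\rho(x))^{-l_0}\le \rho(y)/\rho(x)\le C_0(1+|x-y|/\rho(x))^{l_0/(l_0+1)}$ for all $x,y$. For a ball $B=B(x_0,r)$, $\lambda B=B(x_0,\lambda r)$ and $\Psi_\theta(B)=(1+r/\rho(x_0))^\theta$. $M_{\rho,\theta}f(x)=\sup_{B\ni x}\frac{1}{\Psi_\theta(B)|B|}\int_B|f|$. For $1<p<\infty$, $\omega\in A_p^{\rho,\theta}$ means there is $C$ with $\big(\frac{1}{\Psi_\theta(B)|B|}\int_B\omega\big)\big(\frac{1}{\Psi_\theta(B)|B|}\int_B\omega^{-1/(p-1)}\big)^{p-1}\le C$ for all balls $B$; $\omega\in A_1^{\rho,\theta}$ means $M_{\rho,\theta}\omega\le C\omega$ a.e.; $A_p^{\rho,\infty}=\bigcup_{\theta\ge0}A_p^{\rho,\theta}$. $\omega\in RH_q^{loc}$ ($1<q<\infty$) means $(\frac1{|B|}\int_B\omega^q)^{1/q}\le\frac{C}{|B|}\int_B\omega$ for all balls $B=B(x_0,r)$ with $r<\rho(x_0)$; $RH_1^{loc}$ is all weights; $(q_0/p)'$ is the conjugate exponent of $q_0/p$ (equal to $\infty$ when $p=q_0$, where $RH_\infty^{loc}$ means $\omega(x)\le\frac{C}{|B|}\int_B\omega$ a.e. on such $B$). $L^\infty_c$ denotes bounded compactly supported functions. *)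

theory Defs
  imports "HOL-Analysis.Analysis"
begin

definition ennpow :: "ennreal \<Rightarrow> real \<Rightarrow> ennreal" where
  "ennpow x a = (if x = \<infinity> then \<infinity> else ennreal (enn2real x powr a))"

definition critical_function :: "('a::euclidean_space \<Rightarrow> real) \<Rightarrow> bool" where
  "critical_function \<rho> \<longleftrightarrow> (\<forall>x. \<rho> x > 0) \<and>
     (\<exists>l0 C0. l0 > 0 \<and> C0 > 1 \<and> (\<forall>x y.
        inverse C0 * (1 + dist x y / \<rho> x) powr (- l0) \<le> \<rho> y / \<rho> x \<and>
        \<rho> y / \<rho> x \<le> C0 * (1 + dist x y / \<rho> x) powr (l0 / (l0 + 1))))"

definition Psi :: "('a::euclidean_space \<Rightarrow> real) \<Rightarrow> real \<Rightarrow> 'a \<Rightarrow> real \<Rightarrow> real" where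
  "Psi \<rho> \<theta> x0 r = (1 + r / \<rho> x0) powr \<theta>"

definition avg :: "'a::euclidean_space \<Rightarrow> real \<Rightarrow> ('a \<Rightarrow> ennreal) \<Rightarrow> ennreal" where
  "avg x0 r g = ennreal (1 / measure lebesgue (ball x0 r)) * (\<integral>\<^sup>+ y\<in>ball x0 r. g y \<partial>lebesgue)"

definition avg_psi :: "('a::euclidean_space \<Rightarrow> real) \<Rightarrow> real \<Rightarrow> 'a \<Rightarrow> real \<Rightarrow> ('a \<Rightarrow> ennreal) \<Rightarrow> ennreal" where
  "avg_psi \<rho> \<theta> x0 r g = ennreal (1 / (Psi \<rho> \<theta> x0 r * measure lebesgue (ball x0 r)))
      * (\<integral>\<^sup>+ y\<in>ball x0 r. g y \<partial>lebesgue)"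

definition M_rho :: "('a::euclidean_space \<Rightarrow> real) \<Rightarrow> real \<Rightarrow> ('a \<Rightarrow> real) \<Rightarrow> 'a \<Rightarrow> ennreal" where
  "M_rho \<rho> \<theta> f x = (SUP (x0, r) \<in> {(x0, r). r > 0 \<and> x \<in> ball x0 r}.
      avg_psi \<rho> \<theta> x0 r (\<lambda>y. ennreal \<bar>f y\<bar>))"

definition Lp_norm :: "real \<Rightarrow> ('a::euclidean_space \<Rightarrow> real) \<Rightarrow> ennreal" where
  "Lp_norm p f = ennpow (\<integral>\<^sup>+ y. ennreal (\<bar>f y\<bar> powr p) \<partial>lebesgue) (1 / p)"

definition in_Lp :: "real \<Rightarrow> ('a::euclidean_space \<Rightarrow> real) \<Rightarrow> bool" where
  "in_Lp p f \<longleftrightarrow> f \<in> borel_measurable lebesgue \<and>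
     (\<integral>\<^sup>+ y. ennreal (\<bar>f y\<bar> powr p) \<partial>lebesgue) < \<infinity>"

definition Lp_w_norm :: "real \<Rightarrow> ('a::euclidean_space \<Rightarrow> real) \<Rightarrow> ('a \<Rightarrow> real) \<Rightarrow> ennreal" where
  "Lp_w_norm p \<omega> f = ennpow (\<integral>\<^sup>+ y. ennreal (\<bar>f y\<bar> powr p * \<omega> y) \<partial>lebesgue) (1 / p)"

definition Linf_c :: "('a::euclidean_space \<Rightarrow> real) \<Rightarrow> bool" where
  "Linf_c f \<longleftrightarrow> f \<in> borel_measurable lebesgue \<and> (\<exists>M. \<forall>x. \<bar>f x\<bar> \<le> M) \<and>
     (\<exists>R. \<forall>x. norm x > R \<longrightarrow> f x = 0)"

definition sublinear_bounded_Lp :: "real \<Rightarrow> (('a::euclidean_space \<Rightarrow> real) \<Rightarrow> ('a \<Rightarrow> real)) \<Rightarrow> bool" where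
  "sublinear_bounded_Lp p T \<longleftrightarrow>
     (\<forall>f g. in_Lp p f \<longrightarrow> in_Lp p g \<longrightarrow>
        (AE x in lebesgue. \<bar>T (\<lambda>y. f y + g y) x\<bar> \<le> \<bar>T f x\<bar> + \<bar>T g x\<bar>)) \<and>
     (\<forall>f c. in_Lp p f \<longrightarrow> (AE x in lebesgue. \<bar>T (\<lambda>y. c * f y) x\<bar> = \<bar>c\<bar> * \<bar>T f x\<bar>)) \<and>
     (\<forall>f. in_Lp p f \<longrightarrow> in_Lp p (T f)) \<and>
     (\<exists>C. \<forall>f. in_Lp p f \<longrightarrow> Lp_norm p (T f) \<le> ennreal C * Lp_norm p f)"

definition weight :: "('a::euclidean_space \<Rightarrow> real) \<Rightarrow> bool" where
  "weight \<omega> \<longleftrightarrow> \<omega> \<in> borel_measurable lebesgue \<and> (AE x in lebesgue. \<omega> x > 0) \<and>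
     (\<forall>x0 r. set_integrable lebesgue (ball x0 r) \<omega>)"

text \<open>A_p^{rho,theta} for 1 < p < infinity (both averages are required finite,
  which is implied by the condition for a weight).\<close>
definition A_p_rho :: "('a::euclidean_space \<Rightarrow> real) \<Rightarrow> real \<Rightarrow> real \<Rightarrow> ('a \<Rightarrow> real) \<Rightarrow> bool" where
  "A_p_rho \<rho> \<theta> p \<omega> \<longleftrightarrow> weight \<omega> \<and> (\<exists>C. \<forall>x0 r. r > 0 \<longrightarrow>
     (let a = avg_psi \<rho> \<theta> x0 r (\<lambda>y. ennreal (\<omega> y));
          b = avg_psi \<rho> \<theta> x0 r (\<lambda>y. ennreal (\<omega> y powr (- 1 / (p - 1))))
      in a < \<infinity> \<and> b < \<infinity> \<and> enn2real a * enn2real b powr (p - 1) \<le> C))"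

definition A_p_rho_infty :: "('a::euclidean_space \<Rightarrow> real) \<Rightarrow> real \<Rightarrow> ('a \<Rightarrow> real) \<Rightarrow> bool" where
  "A_p_rho_infty \<rho> p \<omega> \<longleftrightarrow> (\<exists>\<theta>\<ge>0. A_p_rho \<rho> \<theta> p \<omega>)"

definition RH_loc :: "('a::euclidean_space \<Rightarrow> real) \<Rightarrow> ereal \<Rightarrow> ('a \<Rightarrow> real) \<Rightarrow> bool" where
  "RH_loc \<rho> s \<omega> \<longleftrightarrow>
     (if s = \<infinity> then
        (\<exists>C. \<forall>x0 r. 0 < r \<longrightarrow> r < \<rho> x0 \<longrightarrow>
           (AE x in lebesgue. x \<in> ball x0 r \<longrightarrow>
              ennreal (\<omega> x) \<le> ennreal C * avg x0 r (\<lambda>y. ennreal (\<omega> y))))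
      else
        (\<exists>C. \<forall>x0 r. 0 < r \<longrightarrow> r < \<rho> x0 \<longrightarrow>
           ennpow (avg x0 r (\<lambda>y. ennreal (\<omega> y powr real_of_ereal s))) (1 / real_of_ereal s)
             \<le> ennreal C * avg x0 r (\<lambda>y. ennreal (\<omega> y))))"

text \<open>The exponent (q0/p)', with q0 in (1,infinity] and p <= q0.\<close>
definition rh_exponent :: "ereal \<Rightarrow> real \<Rightarrow> ereal" where
  "rh_exponent q0 p = (if q0 = \<infinity> then 1 else if q0 = ereal p then \<infinity>
                       else ereal (real_of_ereal q0 / (real_of_ereal q0 - p)))"

definition ess_sup_ball :: "'a::euclidean_space \<Rightarrow> real \<Rightarrow> ('a \<Rightarrow> real) \<Rightarrow> ennreal" where
  "ess_sup_ball x0 r g = Inf {c. AE y in lebesgue. y \<in> ball x0 r \<longrightarrow> ennreal \<bar>g y\<bar> \<le> c}"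

definition q_avg :: "ereal \<Rightarrow> 'a::euclidean_space \<Rightarrow> real \<Rightarrow> ('a \<Rightarrow> real) \<Rightarrow> ennreal" where
  "q_avg q x0 r g = (if q = \<infinity> then ess_sup_ball x0 r g
      else ennpow (avg x0 r (\<lambda>y. ennreal (\<bar>g y\<bar> powr real_of_ereal q))) (1 / real_of_ereal q))"

end

theory Submission
  imports Defs
begin

text \<open>
  The bound assumed on \<open>T A\<^sub>r f\<close> has no maximal function of \<open>T f\<close> on its right-hand side, so no
  good-\<open>\<lambda>\<close> argument is needed: with \<open>|T f| \<le> |T (f - A\<^sub>r f)| + |T A\<^sub>r f|\<close>, the averages of
  \<open>|T f|\<^sup>p\<^sup>0\<close> over all small balls centred at \<open>x\<close> are at most a constant times
  \<open>M\<^sub>\<rho>\<^sub>,\<^sub>\<theta>(|f|\<^sup>p\<^sup>0)(x)\<close>, and differentiation yields the same pointwise bound for \<open>|T f|\<^sup>p\<^sup>0\<close>.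
  It remains to see that \<open>M\<^sub>\<rho>\<^sub>,\<^sub>\<theta>\<close> is bounded on \<open>L\<^sup>s(\<omega>)\<close>, \<open>s = p/p\<^sub>0\<close>, for \<open>\<theta>\<close> large. Lerner's
  proof of Muckenhoupt's theorem does this without using openness of the \<open>A\<^sub>s\<close> classes: \<open>M\<^sub>\<rho>\<^sub>,\<^sub>\<theta>\<close> is dominated by
  a composition of two maximal functions, with respect to \<open>\<omega>\<close> and to the dual weight \<open>\<sigma>\<close>, each bounded
  on the \<open>L\<^sup>q\<close> spaces of its own measure.
\<close>

section \<open>Powers of extended nonnegative reals\<close>

lemma ennpow_ennreal: "0 \<le> t \<Longrightarrow> ennpow (ennreal t) a = ennreal (t powr a)"
  by (simp add: ennpow_def)

lemma ennpow_top [simp]: "ennpow top a = top"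
  by (simp add: ennpow_def)

lemma ennpow_0 [simp]: "ennpow 0 a = 0"
  by (simp add: ennpow_def)

lemma ennpow_one [simp]: "ennpow x 1 = x"
  by (cases x) (auto simp: ennpow_ennreal)

lemma ennpow_mono: "0 \<le> a \<Longrightarrow> x \<le> y \<Longrightarrow> ennpow x a \<le> ennpow y a"
  by (cases x; cases y) (auto simp: ennpow_ennreal top_unique intro!: ennreal_leI powr_mono2)

lemma ennpow_mult: "0 < a \<Longrightarrow> ennpow (x * y) a = ennpow x a * ennpow y a"
  by (cases x; cases y)
    (auto simp: ennpow_ennreal powr_mult ennreal_mult_top ennreal_top_mult
          simp flip: ennreal_mult)

text \<open>The values 0 and \<open>\<infinity>\<close> are fixed by every exponent, so powers
  compose without a sign condition; a root can therefore undo a power on all of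
  \<open>ennreal\<close>.\<close>

lemma ennpow_ennpow: "ennpow (ennpow x a) b = ennpow x (a * b)"
  by (cases x) (auto simp: ennpow_ennreal powr_powr)

lemma ennpow_add: "0 < a \<Longrightarrow> 0 < b \<Longrightarrow> ennpow x (a + b) = ennpow x a * ennpow x b"
  by (cases x) (auto simp: ennpow_ennreal powr_add ennreal_top_mult simp flip: ennreal_mult)

lemma borel_measurable_ennpow [measurable]:
  assumes [measurable]: "f \<in> borel_measurable M"
  shows "(\<lambda>x. ennpow (f x) a) \<in> borel_measurable M"
  unfolding ennpow_def by measurable

text \<open>Density of \<open>d(t^a)\<close> on the positive half-line, extended by 0: the kernel of
  the layer-cake formula.\<close>

definition layer :: "real \<Rightarrow> real \<Rightarrow> ennreal" where
  "layer a t = ennreal (a * t powr (a - 1)) * indicator {0<..} t"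

lemma borel_measurable_layer [measurable]: "layer a \<in> borel_measurable borel"
  unfolding layer_def by measurable

text \<open>The mass of \<open>d(t^a)\<close> on \<open>0 < t < h\<close> is \<open>h^a\<close>.
  Integrated in a further variable and combined with Tonelli's theorem, this expresses an integral
  of a power through the measures of superlevel sets.\<close>

lemma nn_integral_layer:
  assumes "0 < a"
  shows "(\<integral>\<^sup>+t. layer a t * indicator {t. ennreal t < h} t \<partial>lborel) = ennpow h a"
proof -
  have fin: "(\<integral>\<^sup>+t. layer a t * indicator {t. ennreal t < ennreal c} t \<partial>lborel) = ennreal (c powr a)"
    if c: "0 \<le> c" for c
  proof -
    have "(\<integral>\<^sup>+t. layer a t * indicator {t. ennreal t < ennreal c} t \<partial>lborel)
        = (\<integral>\<^sup>+t. ennreal (indicator {0..c} t * (a * t powr (a - 1))) \<partial>lborel)"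
    proof (rule nn_integral_cong_AE)
      \<comment> \<open>The open condition on \<open>t\<close> and the closed interval of the power
        integral differ only at these two points.\<close>
      have "AE t in lborel. t \<notin> {0, c}"
        by (rule AE_not_in) (auto intro: countable_imp_null_set_lborel)
      then show "AE t in lborel. layer a t * indicator {t. ennreal t < ennreal c} t
          = ennreal (indicator {0..c} t * (a * t powr (a - 1)))"
        by eventually_elim (use c in \<open>auto simp: layer_def indicator_def ennreal_less_iff\<close>)
    qed
    also have "\<dots> = ennreal (c powr a)"
    proof -
      have "((\<lambda>t. a * t powr (a - 1)) has_integral (a * (c powr a / a))) {0..c}"
        using has_integral_powr_from_0[of "a - 1" c] assms c
        by (intro has_integral_mult_right) simp
      then show ?thesis
        using assms
        by (intro nn_integral_has_integral_lebesgue) auto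
    qed
    finally show ?thesis .
  qed
  show ?thesis
  proof (cases h)
    case (real c)
    then show ?thesis using fin[of c] by (simp add: ennpow_ennreal)
  next
    case top
    \<comment> \<open>For \<open>h = \<infinity>\<close>, cutting the integral at level
      \<open>x powr (1/a)\<close> already gives mass \<open>x\<close>, and \<open>x\<close> is
      arbitrary.\<close>
    have *: "ennreal x \<le> (\<integral>\<^sup>+t. layer a t * indicator {t. ennreal t < h} t \<partial>lborel)" if "0 \<le> x" for x
    proof -
      have "ennreal x = ennreal ((x powr (1/a)) powr a)"
        using that assms by (simp add: powr_powr)
      also have "\<dots> = (\<integral>\<^sup>+t. layer a t * indicator {t. ennreal t < ennreal (x powr (1/a))} t \<partial>lborel)"
        by (simp add: fin)
      also have "\<dots> \<le> (\<integral>\<^sup>+t. layer a t * indicator {t. ennreal t < h} t \<partial>lborel)"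
        using top by (intro nn_integral_mono) (auto simp: indicator_def)
      finally show ?thesis .
    qed
    have "(\<integral>\<^sup>+t. layer a t * indicator {t. ennreal t < h} t \<partial>lborel) = top"
    proof (rule ccontr)
      assume "(\<integral>\<^sup>+t. layer a t * indicator {t. ennreal t < h} t \<partial>lborel) \<noteq> top"
      then obtain c where "(\<integral>\<^sup>+t. layer a t * indicator {t. ennreal t < h} t \<partial>lborel) = ennreal c" "0 \<le> c"
        by (metis ennreal_cases)
      with *[of "c + 1"] show False by simp
    qed
    then show ?thesis using top by simp
  qed
qed

section \<open>A maximal function for arbitrary measures\<close>

text \<open>Dilating the ball in the denominator makes the weak type inequality hold for every measure,
  doubling or not.\<close>
definition vitali_max :: "'a::euclidean_space measure \<Rightarrow> ('a \<Rightarrow> ennreal) \<Rightarrow> 'a \<Rightarrow> ennreal" where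
  "vitali_max M f x = (SUP (c, r) \<in> {(c, r). 0 < r \<and> x \<in> ball c r}.
      (\<integral>\<^sup>+y\<in>ball c r. f y \<partial>M) / emeasure M (ball c (5 * r)))"

lemma vitali_max_ge:
  "0 < r \<Longrightarrow> x \<in> ball c r \<Longrightarrow>
    (\<integral>\<^sup>+y\<in>ball c r. f y \<partial>M) / emeasure M (ball c (5 * r)) \<le> vitali_max M f x"
  unfolding vitali_max_def by (rule SUP_upper2[where i="(c, r)"]) auto

text \<open>A ball whose ratio exceeds \<open>t\<close> lies entirely in the superlevel set. The set
  is thus open, which gives measurability, and comes with the family of balls to which the covering
  lemma is applied.\<close>

lemma vitali_max_superlevel:
  "{x. t < vitali_max M f x} = (\<Union>(c, r) \<in> {(c, r). 0 < r \<and>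
      t < (\<integral>\<^sup>+y\<in>ball c r. f y \<partial>M) / emeasure M (ball c (5 * r))}. ball c r)"
  unfolding vitali_max_def by (auto simp: less_SUP_iff) blast

lemma borel_measurable_vitali_max [measurable]:
  assumes "sets M = sets lebesgue"
  shows "vitali_max N f \<in> borel_measurable M"
proof (rule borel_measurableI_greater)
  fix t
  have "open {x. t < vitali_max N f x}"
    unfolding vitali_max_superlevel by auto
  then have "{x. t < vitali_max N f x} \<in> sets lebesgue"
    by (intro sets_completionI_sets) auto
  then show "{x \<in> space M. t < vitali_max N f x} \<in> sets M"
    using assms sets_eq_imp_space_eq[OF assms] by simp
qed

text \<open>Division by \<open>\<infinity>\<close> gives 0, so a ratio above \<open>t\<close> forces
  a finite denominator; \<open>0 / 0\<close> is 0, so over a zero denominator the numerator is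
  nonzero.\<close>

lemma ennreal_less_divide_imp:
  fixes a b :: ennreal
  assumes t: "0 \<le> t" and less: "ennreal t < a / b"
  shows "b < top" "ennreal t * b < a"
proof -
  show "b < top"
    using less by (cases b) auto
  then obtain r where r: "b = ennreal r" "0 \<le> r"
    by (cases b) auto
  show "ennreal t * b < a"
  proof (cases "r = 0")
    case True
    then have "a \<noteq> 0" using less r by auto
    then show ?thesis using True r by (simp add: zero_less_iff_neq_zero)
  next
    case False
    with r have "0 < r" by simp
    show ?thesis
    proof (cases a)
      case (real q)
      then show ?thesis
        using less r t \<open>0 < r\<close>
        by (simp add: divide_ennreal ennreal_less_iff pos_less_divide_eq flip: ennreal_mult)
    next
      case top
      then show ?thesis using r t by (simp flip: ennreal_mult)
    qed
  qed
qed

section \<open>Sums over countable families of sets\<close>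

text \<open>Countable subadditivity, with the sum written as an integral over the counting measure
  so that the family of selected balls needs no enumeration and may be finite or infinite.\<close>

lemma emeasure_UN_le_nn_integral_count_space:
  assumes I: "countable I" and X[measurable]: "\<And>i. i \<in> I \<Longrightarrow> X i \<in> sets M"
  shows "emeasure M (\<Union>(X ` I)) \<le> (\<integral>\<^sup>+i. emeasure M (X i) \<partial>count_space I)"
proof -
  have le: "indicator (\<Union>(X ` I)) x \<le> (\<integral>\<^sup>+i. indicator (X i) x \<partial>count_space I)" for x
  proof (cases "x \<in> \<Union>(X ` I)")
    case True
    then obtain j where j: "x \<in> X j" "j \<in> I" by auto
    have "(\<integral>\<^sup>+i. indicator {j} i \<partial>count_space I) \<le> (\<integral>\<^sup>+i. indicator (X i) x \<partial>count_space I :: ennreal)"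
      using j by (intro nn_integral_mono) (auto simp: indicator_def)
    then show ?thesis using j True by simp
  qed auto
  have "emeasure M (\<Union>(X ` I)) = (\<integral>\<^sup>+x. indicator (\<Union>(X ` I)) x \<partial>M)"
    using I X by (intro nn_integral_indicator[symmetric] sets.countable_UN') auto
  also have "\<dots> \<le> (\<integral>\<^sup>+x. \<integral>\<^sup>+i. indicator (X i) x \<partial>count_space I \<partial>M)"
    by (intro nn_integral_mono le)
  also have "\<dots> = (\<integral>\<^sup>+i. \<integral>\<^sup>+x. indicator (X i) x \<partial>M \<partial>count_space I)"
    using I by (intro nn_integral_count_space_nn_integral) auto
  also have "\<dots> = (\<integral>\<^sup>+i. emeasure M (X i) \<partial>count_space I)"
    by (intro nn_integral_cong) auto
  finally show ?thesis .
qed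

text \<open>Countable additivity of the measure with density \<open>g\<close>.\<close>

lemma nn_integral_count_space_disjoint:
  assumes I: "countable I" and X[measurable]: "\<And>i. i \<in> I \<Longrightarrow> X i \<in> sets M"
    and [measurable]: "g \<in> borel_measurable M" and disj: "disjoint_family_on X I"
  shows "(\<integral>\<^sup>+i. (\<integral>\<^sup>+y\<in>X i. g y \<partial>M) \<partial>count_space I) = (\<integral>\<^sup>+y\<in>\<Union>(X ` I). g y \<partial>M)"
proof -
  have "(\<integral>\<^sup>+i. (\<integral>\<^sup>+y\<in>X i. g y \<partial>M) \<partial>count_space I) = (\<integral>\<^sup>+i. emeasure (density M g) (X i) \<partial>count_space I)"
    by (intro nn_integral_cong) (simp add: emeasure_density)
  also have "\<dots> = emeasure (density M g) (\<Union>(X ` I))"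
    using I disj by (intro emeasure_UN_countable[symmetric]) auto
  also have "\<dots> = (\<integral>\<^sup>+y\<in>\<Union>(X ` I). g y \<partial>M)"
    using I X by (intro emeasure_density sets.countable_UN') auto
  finally show ?thesis .
qed

section \<open>Weak and strong type bounds by Vitali covering and layer cake\<close>

text \<open>Vitali selects disjoint balls whose fivefold dilates cover, and the masses of these
  dilates are exactly the denominators in \<open>vitali_max\<close>. Values of \<open>f\<close> up
  to \<open>t/2\<close> account for at most half of each numerator, so only \<open>2 * f > t\<close>
  remains on the right; this truncated form already contains the interpolation needed for the strong
  type bound.\<close>

lemma vitali_max_weak_type:
  fixes M :: "'a::euclidean_space measure"
  assumes sets: "sets M = sets lebesgue" and f[measurable]: "f \<in> borel_measurable M" and t: "0 < t"
  shows "ennreal t * emeasure M {x. ennreal t < vitali_max M f x}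
    \<le> 2 * (\<integral>\<^sup>+x. f x * indicator {x. ennreal t < 2 * f x} x \<partial>M)" (is "_ \<le> 2 * ?R")
proof -
  have [measurable]: "ball c r \<in> sets M" for c r
    using sets by simp
  define J where "J = {(c::'a, r::real). 0 < r \<and>
      ennreal t < (\<integral>\<^sup>+y\<in>ball c r. f y \<partial>M) / emeasure M (ball c (5 * r))}"
  \<comment> \<open>The covering lemma asks for bounded radii; the bound \<open>n\<close> is removed
    at the end by monotone convergence.\<close>
  define E where "E n = (\<Union>(c, r) \<in> {(c, r) \<in> J. r \<le> real n}. ball c r)" for n :: nat
  let ?g = "\<lambda>x. f x * indicator {x. ennreal t < 2 * f x} x"
  have dens: "ennreal t * emeasure M (ball c (5 * r)) \<le> 2 * (\<integral>\<^sup>+y\<in>ball c r. ?g y \<partial>M)" if "(c, r) \<in> J" for c r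
  proof -
    have "ennreal t < (\<integral>\<^sup>+y\<in>ball c r. f y \<partial>M) / emeasure M (ball c (5 * r))"
      using that by (simp add: J_def)
    note * = ennreal_less_divide_imp[OF less_imp_le[OF t] this]
    have r: "0 < r" using that by (auto simp: J_def)
    have "(\<integral>\<^sup>+y\<in>ball c r. f y \<partial>M) \<le> (\<integral>\<^sup>+y. ?g y * indicator (ball c r) y + ennreal (t/2) * indicator (ball c r) y \<partial>M)"
    proof (intro nn_integral_mono)
      fix y
      have "f y \<le> ennreal (t/2)" if "\<not> ennreal t < 2 * f y"
        using that t by (cases "f y")
          (auto simp: ennreal_less_iff ennreal_mult_top not_less simp flip: ennreal_mult ennreal_numeral)
      then show "f y * indicator (ball c r) y \<le> ?g y * indicator (ball c r) y + ennreal (t/2) * indicator (ball c r) y"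
        by (auto simp: indicator_def)
    qed
    also have "\<dots> = (\<integral>\<^sup>+y\<in>ball c r. ?g y \<partial>M) + ennreal (t/2) * emeasure M (ball c r)"
      by (subst nn_integral_add) (auto simp: nn_integral_cmult_indicator)
    also have "\<dots> \<le> (\<integral>\<^sup>+y\<in>ball c r. ?g y \<partial>M) + ennreal (t/2) * emeasure M (ball c (5 * r))"
      using r by (intro add_left_mono mult_left_mono emeasure_mono) auto
    finally have "ennreal t * emeasure M (ball c (5 * r)) \<le> (\<integral>\<^sup>+y\<in>ball c r. ?g y \<partial>M) + ennreal (t/2) * emeasure M (ball c (5 * r))"
      using *(2) by (meson order.strict_implies_order order_trans)
    \<comment> \<open>The dilated ball has finite mass, so the term with \<open>t/2\<close> can be
      subtracted from both sides.\<close>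
    moreover obtain m where "emeasure M (ball c (5 * r)) = ennreal m" "0 \<le> m"
      using *(1) by (cases "emeasure M (ball c (5 * r))") auto
    ultimately show ?thesis
      using t by (cases "\<integral>\<^sup>+y\<in>ball c r. ?g y \<partial>M")
        (auto simp: ennreal_mult_top simp flip: ennreal_mult ennreal_plus ennreal_numeral)
  qed
  have En: "ennreal t * emeasure M (E n) \<le> 2 * ?R" for n
  proof -
    let ?K = "{i \<in> J. snd i \<le> real n}"
    have cov: "E n \<subseteq> (\<Union>i\<in>?K. ball (fst i) (snd i))"
      unfolding E_def by (auto simp: split_beta)
    have rad: "0 < snd i \<and> snd i \<le> real n" if "i \<in> ?K" for i
      using that by (auto simp: J_def)
    obtain C where C: "countable C" "C \<subseteq> ?K"
      "pairwise (\<lambda>i j. disjnt (ball (fst i) (snd i)) (ball (fst j) (snd j))) C"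
      "E n \<subseteq> (\<Union>i\<in>C. ball (fst i) (5 * snd i))"
      by (rule Vitali_covering_lemma_balls[OF cov rad])
    have "ennreal t * emeasure M (E n) \<le> ennreal t * emeasure M (\<Union>i\<in>C. ball (fst i) (5 * snd i))"
      using C by (intro mult_left_mono emeasure_mono) auto
    also have "\<dots> \<le> ennreal t * (\<integral>\<^sup>+i. emeasure M (ball (fst i) (5 * snd i)) \<partial>count_space C)"
      using C by (intro mult_left_mono emeasure_UN_le_nn_integral_count_space) auto
    also have "\<dots> = (\<integral>\<^sup>+i. ennreal t * emeasure M (ball (fst i) (5 * snd i)) \<partial>count_space C)"
      by (simp add: nn_integral_cmult)
    also have "\<dots> \<le> (\<integral>\<^sup>+i. 2 * (\<integral>\<^sup>+y\<in>ball (fst i) (snd i). ?g y \<partial>M) \<partial>count_space C)"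
      using C(2) dens by (intro nn_integral_mono) auto
    also have "\<dots> = 2 * (\<integral>\<^sup>+i. (\<integral>\<^sup>+y\<in>ball (fst i) (snd i). ?g y \<partial>M) \<partial>count_space C)"
      by (simp add: nn_integral_cmult)
    also have "(\<integral>\<^sup>+i. (\<integral>\<^sup>+y\<in>ball (fst i) (snd i). ?g y \<partial>M) \<partial>count_space C)
        = (\<integral>\<^sup>+y\<in>(\<Union>i\<in>C. ball (fst i) (snd i)). ?g y \<partial>M)"
      using C(1,3) by (intro nn_integral_count_space_disjoint)
        (auto simp: disjoint_family_on_def pairwise_def disjnt_def)
    also have "\<dots> \<le> ?R"
      by (intro nn_integral_mono) (auto simp: indicator_def)
    finally show ?thesis
      by (simp add: mult_left_mono)
  qed
  have "{x. ennreal t < vitali_max M f x} = (\<Union>n. E n)"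
  proof -
    have "{x. ennreal t < vitali_max M f x} = (\<Union>(c, r) \<in> J. ball c r)"
      unfolding vitali_max_superlevel J_def ..
    also have "\<dots> = (\<Union>n. E n)"
      unfolding E_def using real_arch_simple by fast
    finally show ?thesis .
  qed
  also have "emeasure M \<dots> = (SUP n. emeasure M (E n))"
  proof (rule SUP_emeasure_incseq[symmetric])
    have "open (E n)" for n unfolding E_def by auto
    then show "range E \<subseteq> sets M" using sets by auto
    show "incseq E"
    proof (rule incseq_SucI)
      fix n show "E n \<subseteq> E (Suc n)"
        unfolding E_def by (intro UN_mono) auto
    qed
  qed
  also have "ennreal t * \<dots> = (SUP n. ennreal t * emeasure M (E n))"
    by (simp add: SUP_mult_left_ennreal)
  also have "\<dots> \<le> 2 * ?R"
    using En by (intro SUP_least)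
  finally show ?thesis .
qed

text \<open>The layer-cake formula turns the left side into an integral of superlevel measures.
  After the weak type bound and Tonelli, the inner integral is again a layer-cake integral, with
  exponent \<open>p - 1 > 0\<close> and height \<open>2 * f x\<close>.\<close>

lemma vitali_max_strong_type:
  fixes M :: "'a::euclidean_space measure"
  assumes sets: "sets M = sets lebesgue" and sf: "sigma_finite_measure M"
    and f[measurable]: "f \<in> borel_measurable M" and p: "1 < p"
  shows "(\<integral>\<^sup>+x. ennpow (vitali_max M f x) p \<partial>M)
    \<le> ennreal (2 powr p * p / (p - 1)) * (\<integral>\<^sup>+x. ennpow (f x) p \<partial>M)"
proof -
  interpret M: sigma_finite_measure M by fact
  interpret pair_sigma_finite lborel M ..
  note [measurable] = borel_measurable_vitali_max[OF sets]
  have sp: "space M = UNIV"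
    using sets_eq_imp_space_eq[OF sets] by simp
  let ?F = "vitali_max M f"
  have "(\<integral>\<^sup>+x. ennpow (?F x) p \<partial>M)
      = (\<integral>\<^sup>+x. \<integral>\<^sup>+t. layer p t * indicator {t. ennreal t < ?F x} t \<partial>lborel \<partial>M)"
    using p by (simp add: nn_integral_layer)
  also have "\<dots> = (\<integral>\<^sup>+t. \<integral>\<^sup>+x. layer p t * indicator {t. ennreal t < ?F x} t \<partial>M \<partial>lborel)"
    unfolding indicator_def mem_Collect_eq by (rule Fubini') measurable
  also have "\<dots> = (\<integral>\<^sup>+t. layer p t * emeasure M {x. ennreal t < ?F x} \<partial>lborel)"
  proof (intro nn_integral_cong)
    fix t :: real
    have "{x. ennreal t < ?F x} = {x \<in> space M. ennreal t < ?F x}" using sp by simp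
    then have [measurable]: "{x. ennreal t < ?F x} \<in> sets M" by (simp only:) measurable
    have "(\<integral>\<^sup>+x. layer p t * indicator {t. ennreal t < ?F x} t \<partial>M)
        = (\<integral>\<^sup>+x. layer p t * indicator {x. ennreal t < ?F x} x \<partial>M)"
      by (intro nn_integral_cong) (auto simp: indicator_def)
    then show "(\<integral>\<^sup>+x. layer p t * indicator {t. ennreal t < ?F x} t \<partial>M)
        = layer p t * emeasure M {x. ennreal t < ?F x}"
      by (simp add: nn_integral_cmult)
  qed
  also have "\<dots> \<le> (\<integral>\<^sup>+t. \<integral>\<^sup>+x. ennreal (2 * p / (p - 1)) * f x *
      (layer (p - 1) t * indicator {t. ennreal t < 2 * f x} t) \<partial>M \<partial>lborel)"
  proof (intro nn_integral_mono)
    fix t :: real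
    show "layer p t * emeasure M {x. ennreal t < ?F x} \<le> (\<integral>\<^sup>+x. ennreal (2 * p / (p - 1)) * f x *
      (layer (p - 1) t * indicator {t. ennreal t < 2 * f x} t) \<partial>M)"
    proof (cases "0 < t")
      case True
      \<comment> \<open>One factor \<open>t\<close> is split off to be spent on the weak type
        inequality, leaving the kernel of exponent \<open>p - 1\<close>.\<close>
      have "layer p t = ennreal (p / (p - 1)) * layer (p - 1) t * ennreal t"
      proof -
        have "p * t powr (p - 1) = p / (p - 1) * ((p - 1) * t powr (p - 1 - 1)) * t"
          using True p powr_diff[of t "p - 1" 1] by simp
        then show ?thesis
          using True p by (simp add: layer_def flip: ennreal_mult)
      qed
      then have "layer p t * emeasure M {x. ennreal t < ?F x}
          = ennreal (p / (p - 1)) * layer (p - 1) t * (ennreal t * emeasure M {x. ennreal t < ?F x})"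
        by (simp add: mult.assoc)
      also have "\<dots> \<le> ennreal (p / (p - 1)) * layer (p - 1) t *
          (2 * (\<integral>\<^sup>+x. f x * indicator {x. ennreal t < 2 * f x} x \<partial>M))"
        by (intro mult_left_mono vitali_max_weak_type sets f True) auto
      also have "\<dots> = ennreal (2 * p / (p - 1)) * layer (p - 1) t *
          (\<integral>\<^sup>+x. f x * indicator {x. ennreal t < 2 * f x} x \<partial>M)"
      proof -
        have "ennreal (2 * p / (p - 1)) = 2 * ennreal (p / (p - 1))"
          using ennreal_mult[of 2 "p / (p - 1)"] p by simp
        then show ?thesis by (simp add: ac_simps)
      qed
      also have "\<dots> = (\<integral>\<^sup>+x. ennreal (2 * p / (p - 1)) * layer (p - 1) t *
          (f x * indicator {x. ennreal t < 2 * f x} x) \<partial>M)"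
        using sp by (intro nn_integral_cmult[symmetric]) measurable
      also have "\<dots> = (\<integral>\<^sup>+x. ennreal (2 * p / (p - 1)) * f x *
          (layer (p - 1) t * indicator {t. ennreal t < 2 * f x} t) \<partial>M)"
        by (intro nn_integral_cong) (auto simp: indicator_def ac_simps)
      finally show ?thesis .
    qed (simp add: layer_def)
  qed
  also have "\<dots> = (\<integral>\<^sup>+x. \<integral>\<^sup>+t. ennreal (2 * p / (p - 1)) * f x *
      (layer (p - 1) t * indicator {t. ennreal t < 2 * f x} t) \<partial>lborel \<partial>M)"
    unfolding indicator_def mem_Collect_eq by (rule Fubini'[symmetric]) measurable
  also have "\<dots> = (\<integral>\<^sup>+x. ennreal (2 * p / (p - 1)) * f x * ennpow (2 * f x) (p - 1) \<partial>M)"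
    using p by (simp add: nn_integral_cmult nn_integral_layer)
  also have "\<dots> = (\<integral>\<^sup>+x. ennreal (2 powr p * p / (p - 1)) * ennpow (f x) p \<partial>M)"
  proof (intro nn_integral_cong)
    fix x
    have "ennreal (2 * p / (p - 1)) * ennpow 2 (p - 1) = ennreal (2 powr p * p / (p - 1))"
      using p ennpow_ennreal[of 2 "p - 1"] by (simp add: powr_diff field_simps flip: ennreal_mult)
    moreover have "f x * ennpow (f x) (p - 1) = ennpow (f x) p"
      using p ennpow_add[of 1 "p - 1" "f x"] by simp
    ultimately have "(ennreal (2 * p / (p - 1)) * ennpow 2 (p - 1)) * (f x * ennpow (f x) (p - 1))
        = ennreal (2 powr p * p / (p - 1)) * ennpow (f x) p"
      by simp
    then show "ennreal (2 * p / (p - 1)) * f x * ennpow (2 * f x) (p - 1)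
        = ennreal (2 powr p * p / (p - 1)) * ennpow (f x) p"
      using p by (simp add: ennpow_mult ac_simps)
  qed
  also have "\<dots> = ennreal (2 powr p * p / (p - 1)) * (\<integral>\<^sup>+x. ennpow (f x) p \<partial>M)"
    by (simp add: nn_integral_cmult)
  finally show ?thesis .
qed

section \<open>Weighted bounds for the maximal operator\<close>

text \<open>A density that is finite everywhere preserves the sigma-finiteness of Lebesgue measure.
  This makes the strong type bound available for both weighted measures.\<close>

lemma sigma_finite_density_lebesgue:
  fixes h :: "'a::euclidean_space \<Rightarrow> real"
  assumes "h \<in> borel_measurable lebesgue"
  shows "sigma_finite_measure (density lebesgue (\<lambda>x. ennreal (h x)))"
proof -
  interpret sigma_finite_measure "lebesgue :: 'a measure"
  proof
    obtain A :: "'a set set" where "countable A" "A \<subseteq> sets lborel" "\<Union>A = space lborel" "\<forall>a\<in>A. emeasure lborel a \<noteq> \<infinity>"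
      using lborel.sigma_finite_countable by metis
    then show "\<exists>A::'a set set. countable A \<and> A \<subseteq> sets lebesgue \<and> \<Union>A = space lebesgue \<and> (\<forall>a\<in>A. emeasure lebesgue a \<noteq> \<infinity>)"
      by (intro exI[of _ A]) (auto dest: sets_completionI_sets)
  qed
  show ?thesis
    using assms by (subst sigma_finite_iff_density_finite) auto
qed

lemma emeasure_ball_eq_measure: "emeasure lebesgue (ball c r) = ennreal (measure lebesgue (ball c r))"
  using emeasure_lborel_ball_finite[of c r] by (intro emeasure_eq_ennreal_measure) auto

lemma ennreal_mult_finiteE:
  assumes "ennreal k * X < \<infinity>" "0 < k"
  obtains w where "X = ennreal w" "0 \<le> w"
  using assms by (cases X) (auto simp: ennreal_mult_top)

text \<open>A zero integral would make \<open>h\<close> vanish almost everywhere on a ball of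
  positive measure. The masses of balls for \<open>\<omega>\<close> and \<open>\<sigma>\<close> can
  therefore serve as divisors.\<close>

lemma nn_integral_ball_pos:
  fixes h :: "'a::euclidean_space \<Rightarrow> real"
  assumes [measurable]: "h \<in> borel_measurable lebesgue" and pos: "AE x in lebesgue. 0 < h x" and r: "0 < r"
  shows "0 < (\<integral>\<^sup>+y\<in>ball c r. ennreal (h y) \<partial>lebesgue)"
proof (rule ccontr)
  assume "\<not> ?thesis"
  moreover have [measurable]: "ball c r \<in> sets lebesgue" by simp
  have meas: "(\<lambda>y. ennreal (h y) * indicator (ball c r) y) \<in> borel_measurable lebesgue"
    by measurable
  ultimately have "(\<integral>\<^sup>+y\<in>ball c r. ennreal (h y) \<partial>lebesgue) = 0"
    by (simp add: zero_less_iff_neq_zero)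
  then have "AE y in lebesgue. ennreal (h y) * indicator (ball c r) y = 0"
    using nn_integral_0_iff_AE[OF meas] by simp
  with pos have "AE y in lebesgue. y \<notin> ball c r"
    by eventually_elim (auto simp: indicator_def split: if_splits)
  then have "emeasure lebesgue (ball c r) = 0"
    by (subst (asm) AE_iff_measurable[where N="ball c r"]) auto
  then show False
    using content_ball_pos[OF r, of c] by (simp add: emeasure_ball_eq_measure)
qed

text \<open>The condition on \<open>\<theta>'\<close> says
  \<open>\<theta> * s \<le> \<theta>' * (s - 1)\<close>. Hence the powers of \<open>Psi\<close> lost
  in applying the \<open>A_p\<close> condition to \<open>5B\<close> are paid for by the larger
  exponent in \<open>M_rho\<close>.\<close>

lemma Psi_dilate_bound:
  assumes "0 < \<rho> c" "0 < r" "0 \<le> \<theta>" "1 < s" "\<theta> * s / (s - 1) \<le> \<theta>'"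
  shows "Psi \<rho> \<theta> c (5 * r) powr s \<le> 5 powr (\<theta> * s) * Psi \<rho> \<theta>' c r powr (s - 1)"
proof -
  define u where "u = 1 + r / \<rho> c"
  have u: "1 \<le> u" using assms by (simp add: u_def)
  have "1 + 5 * r / \<rho> c \<le> 5 * u" using assms by (simp add: u_def)
  then have "Psi \<rho> \<theta> c (5 * r) powr s \<le> ((5 * u) powr \<theta>) powr s"
    using assms unfolding Psi_def by (intro powr_mono2) auto
  also have "\<dots> = 5 powr (\<theta> * s) * u powr (\<theta> * s)"
    using u by (simp add: powr_powr powr_mult)
  also have "\<dots> \<le> 5 powr (\<theta> * s) * u powr (\<theta>' * (s - 1))"
    using u assms by (intro mult_left_mono powr_mono) (auto simp: field_simps)
  also have "u powr (\<theta>' * (s - 1)) = Psi \<rho> \<theta>' c r powr (s - 1)"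
    by (simp add: Psi_def u_def powr_powr)
  finally show ?thesis .
qed

text \<open>Lerner's pointwise estimate: on a ball \<open>B\<close> the average of \<open>\<phi>\<close> is controlled by
  \<open>m = \<sigma>(5B)\<inverse> \<integral>\<^sub>B \<phi>\<close>, which bounds the maximal function for \<open>\<sigma>\<close> from below on
  all of \<open>B\<close>; the factor \<open>1 / \<omega>\<close> turns the outer \<open>\<omega>\<close>-average back into a Lebesgue average.\<close>
lemma M_rho_le_iterated_vitali_max:
  fixes \<rho> :: "'a::euclidean_space \<Rightarrow> real"
  assumes \<sigma>_def: "\<sigma> = (\<lambda>y. \<omega> y powr (- 1 / (s - 1)))"
    and rho: "\<And>x. 0 < \<rho> x" and s: "1 < s" and \<theta>: "0 \<le> \<theta>" "\<theta> * s / (s - 1) \<le> \<theta>'"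
    and A: "A_p_rho \<rho> \<theta> s \<omega>"
  shows "\<exists>K\<ge>0. \<forall>\<phi>\<in>borel_measurable lebesgue. \<forall>x.
    ennpow (M_rho \<rho> \<theta>' \<phi> x) (s - 1) \<le> ennreal K * vitali_max (density lebesgue \<omega>)
      (\<lambda>y. ennpow (vitali_max (density lebesgue \<sigma>) (\<lambda>z. ennreal (\<bar>\<phi> z\<bar> / \<sigma> z)) y) (s - 1)
        * ennreal (1 / \<omega> y)) x"
proof -
  have \<omega>[measurable]: "\<omega> \<in> borel_measurable lebesgue" and \<omega>_pos: "AE x in lebesgue. 0 < \<omega> x"
    using A by (auto simp: A_p_rho_def weight_def)
  have \<sigma>[measurable]: "\<sigma> \<in> borel_measurable lebesgue"
    unfolding \<sigma>_def by measurable
  have \<sigma>_pos: "AE x in lebesgue. 0 < \<sigma> x"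
    using \<omega>_pos by eventually_elim (simp add: \<sigma>_def)
  obtain C where C: "\<And>c r. 0 < r \<Longrightarrow> (let a = avg_psi \<rho> \<theta> c r (\<lambda>y. ennreal (\<omega> y));
          b = avg_psi \<rho> \<theta> c r (\<lambda>y. ennreal (\<sigma> y))
      in a < \<infinity> \<and> b < \<infinity> \<and> enn2real a * enn2real b powr (s - 1) \<le> C)"
    using A unfolding A_p_rho_def \<sigma>_def by blast
  let ?n = "5 ^ DIM('a) :: real"
  \<comment> \<open>The factors come from the \<open>A_p\<close> constant, from the volume ratio of
    \<open>5B\<close> to \<open>B\<close> to the power \<open>s\<close>, and from the dilation of
    \<open>Psi\<close>.\<close>
  define K where "K = \<bar>C\<bar> * ?n powr s * 5 powr (\<theta> * s)"
  show ?thesis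
  proof (intro exI[of _ K] conjI ballI allI)
    show "0 \<le> K" by (simp add: K_def)
  next
    fix \<phi> :: "'a \<Rightarrow> real" and x
    assume [measurable]: "\<phi> \<in> borel_measurable lebesgue"
    define Q where "Q = vitali_max (density lebesgue \<sigma>) (\<lambda>z. ennreal (\<bar>\<phi> z\<bar> / \<sigma> z))"
    have [measurable]: "Q \<in> borel_measurable lebesgue" unfolding Q_def by measurable
    define g where "g = (\<lambda>y. ennpow (Q y) (s - 1) * ennreal (1 / \<omega> y))"
    have [measurable]: "g \<in> borel_measurable lebesgue" unfolding g_def by measurable
    have ball: "ennpow (avg_psi \<rho> \<theta>' c r (\<lambda>y. ennreal \<bar>\<phi> y\<bar>)) (s - 1)
        \<le> ennreal K * vitali_max (density lebesgue \<omega>) g x" if r: "0 < r" and x: "x \<in> ball c r" for c r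
    proof -
      let ?V = "measure lebesgue (ball c r)"
      define I where "I = (\<integral>\<^sup>+y\<in>ball c r. ennreal \<bar>\<phi> y\<bar> \<partial>lebesgue)"
      define P5 where "P5 = Psi \<rho> \<theta> c (5 * r)"
      define P where "P = Psi \<rho> \<theta>' c r"
      have [measurable]: "ball c r \<in> sets lebesgue" "ball c (5 * r) \<in> sets lebesgue" by simp_all
      have V: "0 < ?V" using content_ball_pos[OF r, of c] by simp
      have V5: "measure lebesgue (ball c (5 * r)) = ?n * ?V"
        using r content_ball_conv_unit_ball[of "5 * r" c] content_ball_conv_unit_ball[of r c]
        by (simp add: power_mult_distrib)
      have u: "0 < 1 + r / \<rho> c" "0 < 1 + 5 * r / \<rho> c"
        using rho[of c] r by (auto intro!: add_pos_pos)
      then have P: "0 < P" "0 < P5"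
        by (auto simp: P_def P5_def Psi_def)
      \<comment> \<open>The weights are measured on \<open>5B\<close>, where
        \<open>vitali_max\<close> takes its denominators.\<close>
      define W where "W = (\<integral>\<^sup>+y\<in>ball c (5 * r). ennreal (\<omega> y) \<partial>lebesgue)"
      define S where "S = (\<integral>\<^sup>+y\<in>ball c (5 * r). ennreal (\<sigma> y) \<partial>lebesgue)"
      have avgs: "avg_psi \<rho> \<theta> c (5 * r) (\<lambda>y. ennreal (\<omega> y)) = ennreal (1 / (P5 * (?n * ?V))) * W"
        "avg_psi \<rho> \<theta> c (5 * r) (\<lambda>y. ennreal (\<sigma> y)) = ennreal (1 / (P5 * (?n * ?V))) * S"
        by (simp_all add: avg_psi_def V5 P5_def W_def S_def)
      have k: "0 < 1 / (P5 * (?n * ?V))" using P V by simp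
      have fin: "ennreal (1 / (P5 * (?n * ?V))) * W < \<infinity>" "ennreal (1 / (P5 * (?n * ?V))) * S < \<infinity>"
        and prod: "enn2real (ennreal (1 / (P5 * (?n * ?V))) * W) * enn2real (ennreal (1 / (P5 * (?n * ?V))) * S) powr (s - 1) \<le> C"
        using C[of "5 * r" c] r by (simp_all add: avgs Let_def)
      obtain w where w: "W = ennreal w" "0 \<le> w"
        using ennreal_mult_finiteE[OF fin(1) k] .
      obtain t where t: "S = ennreal t" "0 \<le> t"
        using ennreal_mult_finiteE[OF fin(2) k] .
      have "0 < W" "0 < S"
        unfolding W_def S_def using \<omega>_pos \<sigma>_pos r by (auto intro!: nn_integral_ball_pos)
      then have wt: "0 < w" "0 < t" using w t by auto
      \<comment> \<open>Here \<open>a\<close> and \<open>b\<close> are the two averages of the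
        \<open>A_p\<close> condition on \<open>5B\<close>. Expressing \<open>w\<close> and
        \<open>t\<close> through them leaves \<open>P5 powr s\<close>, which
        \<open>P powr (s - 1)\<close> absorbs.\<close>
      have real: "(t / (P * ?V)) powr (s - 1) * (w / ?V) \<le> K"
      proof -
        define a where "a = w / (P5 * (?n * ?V))"
        define b where "b = t / (P5 * (?n * ?V))"
        have ab: "0 < a" "0 < b" using wt P V by (simp_all add: a_def b_def)
        have abC: "a * b powr (s - 1) \<le> \<bar>C\<bar>"
          using prod w t k by (simp add: a_def b_def flip: ennreal_mult)
        have "t / (P * ?V) = b * (P5 * ?n) / P" "w / ?V = a * (P5 * ?n)"
          using P V by (simp_all add: a_def b_def)
        then have "(t / (P * ?V)) powr (s - 1) * (w / ?V)
            = (a * b powr (s - 1)) * (((P5 * ?n) powr (s - 1) * (P5 * ?n)) / P powr (s - 1))"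
          using P ab by (simp add: powr_mult powr_divide)
        also have "(P5 * ?n) powr (s - 1) * (P5 * ?n) = ?n powr s * P5 powr s"
          using P by (simp add: powr_diff powr_mult)
        also have "(a * b powr (s - 1)) * (?n powr s * P5 powr s / P powr (s - 1))
            \<le> \<bar>C\<bar> * (?n powr s * P5 powr s / P powr (s - 1))"
          by (intro mult_right_mono abC) auto
        also have "\<dots> \<le> \<bar>C\<bar> * (?n powr s * 5 powr (\<theta> * s))"
        proof (intro mult_left_mono)
          have "P5 powr s / P powr (s - 1) \<le> 5 powr (\<theta> * s)"
            using Psi_dilate_bound[of \<rho> c r \<theta> s \<theta>'] rho r \<theta> s P
            by (simp add: P5_def P_def pos_divide_le_eq)
          then show "?n powr s * P5 powr s / P powr (s - 1) \<le> ?n powr s * 5 powr (\<theta> * s)"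
            by (metis mult_left_mono powr_ge_zero times_divide_eq_right)
        qed auto
        finally show ?thesis by (simp add: K_def)
      qed
      have I_eq: "I = (\<integral>\<^sup>+y\<in>ball c r. ennreal (\<bar>\<phi> y\<bar> / \<sigma> y) \<partial>density lebesgue \<sigma>)"
      proof -
        have "(\<integral>\<^sup>+y\<in>ball c r. ennreal (\<bar>\<phi> y\<bar> / \<sigma> y) \<partial>density lebesgue \<sigma>)
            = (\<integral>\<^sup>+y. ennreal (\<sigma> y) * (ennreal (\<bar>\<phi> y\<bar> / \<sigma> y) * indicator (ball c r) y) \<partial>lebesgue)"
          by (rule nn_integral_density) measurable
        also have "\<dots> = I"
          unfolding I_def
        proof (rule nn_integral_cong_AE)
          show "AE y in lebesgue. ennreal (\<sigma> y) * (ennreal (\<bar>\<phi> y\<bar> / \<sigma> y) * indicator (ball c r) y)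
              = ennreal \<bar>\<phi> y\<bar> * indicator (ball c r) y"
            using \<sigma>_pos by eventually_elim (simp add: indicator_def flip: ennreal_mult)
        qed
        finally show ?thesis by simp
      qed
      define m where "m = I / ennreal t"
      have I_m: "I = ennreal t * m"
        unfolding m_def using wt by (simp add: ennreal_times_divide mult.commute[of _ I] ennreal_mult_divide_eq)
      have emS: "emeasure (density lebesgue \<sigma>) (ball c (5 * r)) = ennreal t"
        using t(1) unfolding S_def by (simp add: emeasure_density)
      have emW: "emeasure (density lebesgue \<omega>) (ball c (5 * r)) = ennreal w"
        using w(1) unfolding W_def by (simp add: emeasure_density)
      have m_le: "m \<le> Q y" if "y \<in> ball c r" for y
        using vitali_max_ge[OF r that, where f="\<lambda>z. ennreal (\<bar>\<phi> z\<bar> / \<sigma> z)" and M="density lebesgue \<sigma>"]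
        unfolding Q_def m_def I_eq emS .
      define v where "v = vitali_max (density lebesgue \<omega>) g x"
      have "ennpow m (s - 1) * ennreal ?V = (\<integral>\<^sup>+y\<in>ball c r. ennpow m (s - 1) \<partial>lebesgue)"
        by (simp add: nn_integral_cmult_indicator emeasure_ball_eq_measure)
      also have "\<dots> \<le> (\<integral>\<^sup>+y. ennreal (\<omega> y) * (g y * indicator (ball c r) y) \<partial>lebesgue)"
      proof (rule nn_integral_mono_AE)
        show "AE y in lebesgue. ennpow m (s - 1) * indicator (ball c r) y
            \<le> ennreal (\<omega> y) * (g y * indicator (ball c r) y)"
          using \<omega>_pos
        proof eventually_elim
          case (elim y)
          have "ennreal (\<omega> y) * g y = ennpow (Q y) (s - 1)"
          proof -
            have "ennreal (\<omega> y) * g y = (ennreal (\<omega> y) * ennreal (1 / \<omega> y)) * ennpow (Q y) (s - 1)"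
              by (simp add: g_def ac_simps)
            also have "ennreal (\<omega> y) * ennreal (1 / \<omega> y) = 1"
              using elim by (simp flip: ennreal_mult)
            finally show ?thesis by simp
          qed
          then show ?case
            using m_le s by (auto simp: indicator_def intro!: ennpow_mono)
        qed
      qed
      also have "\<dots> = (\<integral>\<^sup>+y\<in>ball c r. g y \<partial>density lebesgue \<omega>)"
        by (rule nn_integral_density[symmetric]) measurable
      also have "\<dots> = ennreal w * ((\<integral>\<^sup>+y\<in>ball c r. g y \<partial>density lebesgue \<omega>) / ennreal w)"
        using wt by (simp add: ennreal_times_divide mult.commute[of "ennreal w"] ennreal_mult_divide_eq)
      also have "\<dots> \<le> ennreal w * v"
        using vitali_max_ge[OF r x, where f=g and M="density lebesgue \<omega>"] unfolding v_def emW by (intro mult_left_mono) auto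
      finally have mv: "ennpow m (s - 1) * ennreal ?V \<le> ennreal w * v" .
      have "ennpow m (s - 1) = ennpow m (s - 1) * ennreal ?V * ennreal (1 / ?V)"
        using V by (simp add: mult.assoc flip: ennreal_mult)
      also have "\<dots> \<le> ennreal w * v * ennreal (1 / ?V)"
        by (intro mult_right_mono mv) auto
      also have "\<dots> = ennreal (w / ?V) * v"
      proof -
        have "ennreal (w / ?V) = ennreal w * ennreal (1 / ?V)"
          using wt V by (simp flip: ennreal_mult)
        then show ?thesis by (simp add: ac_simps)
      qed
      finally have mv': "ennpow m (s - 1) \<le> ennreal (w / ?V) * v" .
      have "avg_psi \<rho> \<theta>' c r (\<lambda>y. ennreal \<bar>\<phi> y\<bar>) = ennreal (t / (P * ?V)) * m"
      proof -
        have "avg_psi \<rho> \<theta>' c r (\<lambda>y. ennreal \<bar>\<phi> y\<bar>) = ennreal (1 / (P * ?V)) * I"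
          by (simp add: avg_psi_def P_def I_def)
        also have "\<dots> = (ennreal (1 / (P * ?V)) * ennreal t) * m"
          by (simp add: I_m mult.assoc)
        also have "ennreal (1 / (P * ?V)) * ennreal t = ennreal (t / (P * ?V))"
          using P V wt by (simp flip: ennreal_mult)
        finally show ?thesis .
      qed
      then have "ennpow (avg_psi \<rho> \<theta>' c r (\<lambda>y. ennreal \<bar>\<phi> y\<bar>)) (s - 1)
          = ennreal ((t / (P * ?V)) powr (s - 1)) * ennpow m (s - 1)"
        using s P V wt by (simp add: ennpow_mult ennpow_ennreal)
      also have "\<dots> \<le> ennreal ((t / (P * ?V)) powr (s - 1)) * (ennreal (w / ?V) * v)"
        by (intro mult_left_mono mv') auto
      also have "\<dots> = ennreal ((t / (P * ?V)) powr (s - 1) * (w / ?V)) * v"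
        using ennreal_mult[of "(t / (P * ?V)) powr (s - 1)" "w / ?V"] wt V
        by (simp add: mult.assoc del: times_divide_eq_right)
      also have "\<dots> \<le> ennreal K * v"
        by (intro mult_right_mono ennreal_leI real) auto
      finally show ?thesis unfolding v_def .
    qed
    have inv: "ennpow (ennpow y (s - 1)) (1 / (s - 1)) = y" for y
      using s by (simp add: ennpow_ennpow)
    \<comment> \<open>The root is taken ball by ball, before the supremum, and undone afterwards;
      only monotonicity of powers is then involved.\<close>
    have "M_rho \<rho> \<theta>' \<phi> x \<le> ennpow (ennreal K * vitali_max (density lebesgue \<omega>) g x) (1 / (s - 1))"
      unfolding M_rho_def
    proof (intro SUP_least)
      fix z assume "z \<in> {(x0, r). 0 < r \<and> x \<in> ball x0 r}"
      then obtain c r where z: "z = (c, r)" "0 < r" "x \<in> ball c r" by auto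
      have "avg_psi \<rho> \<theta>' c r (\<lambda>y. ennreal \<bar>\<phi> y\<bar>)
          = ennpow (ennpow (avg_psi \<rho> \<theta>' c r (\<lambda>y. ennreal \<bar>\<phi> y\<bar>)) (s - 1)) (1 / (s - 1))"
        by (simp add: inv)
      also have "\<dots> \<le> ennpow (ennreal K * vitali_max (density lebesgue \<omega>) g x) (1 / (s - 1))"
        using s by (intro ennpow_mono ball z) auto
      finally show "(case z of (x0, r) \<Rightarrow> avg_psi \<rho> \<theta>' x0 r (\<lambda>y. ennreal \<bar>\<phi> y\<bar>))
          \<le> ennpow (ennreal K * vitali_max (density lebesgue \<omega>) g x) (1 / (s - 1))"
        by (simp add: z)
    qed
    then have "ennpow (M_rho \<rho> \<theta>' \<phi> x) (s - 1)
        \<le> ennpow (ennpow (ennreal K * vitali_max (density lebesgue \<omega>) g x) (1 / (s - 1))) (s - 1)"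
      using s by (intro ennpow_mono) auto
    also have "\<dots> = ennreal K * vitali_max (density lebesgue \<omega>) g x"
      using s by (simp add: ennpow_ennpow)
    finally show "ennpow (M_rho \<rho> \<theta>' \<phi> x) (s - 1) \<le> ennreal K * vitali_max (density lebesgue \<omega>)
      (\<lambda>y. ennpow (vitali_max (density lebesgue \<sigma>) (\<lambda>z. ennreal (\<bar>\<phi> z\<bar> / \<sigma> z)) y) (s - 1)
        * ennreal (1 / \<omega> y)) x"
      unfolding g_def Q_def .
  qed
qed

text \<open>The iterated bound is raised to the conjugate exponent \<open>s' = s / (s - 1)\<close>,
  which restores the power \<open>s\<close> of \<open>M_rho\<close>. The outer maximal function is
  bounded on \<open>L^{s'}(\<omega>)\<close>; the identity
  \<open>\<omega>^{1 - s'} = \<sigma>\<close> then moves the integral to \<open>\<sigma>\<close>,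
  where the inner one is bounded on \<open>L^s(\<sigma>)\<close>; finally
  \<open>\<sigma>^{1 - s} = \<omega>\<close> brings back the weight \<open>\<omega>\<close>.\<close>

theorem M_rho_weighted_strong_type:
  fixes \<rho> :: "'a::euclidean_space \<Rightarrow> real"
  assumes rho: "\<And>x. 0 < \<rho> x" and s: "1 < s" and \<theta>: "0 \<le> \<theta>" "\<theta> * s / (s - 1) \<le> \<theta>'"
    and A: "A_p_rho \<rho> \<theta> s \<omega>"
  shows "\<exists>K\<ge>0. \<forall>\<phi>\<in>borel_measurable lebesgue.
    (\<integral>\<^sup>+x. ennpow (M_rho \<rho> \<theta>' \<phi> x) s * ennreal (\<omega> x) \<partial>lebesgue)
      \<le> ennreal K * (\<integral>\<^sup>+x. ennreal (\<bar>\<phi> x\<bar> powr s * \<omega> x) \<partial>lebesgue)"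
proof -
  have \<omega>[measurable]: "\<omega> \<in> borel_measurable lebesgue" and \<omega>_pos: "AE x in lebesgue. 0 < \<omega> x"
    using A by (auto simp: A_p_rho_def weight_def)
  define \<sigma> where "\<sigma> = (\<lambda>y. \<omega> y powr (- 1 / (s - 1)))"
  have \<sigma>[measurable]: "\<sigma> \<in> borel_measurable lebesgue"
    unfolding \<sigma>_def by measurable
  obtain K where K: "0 \<le> K" "\<And>\<phi> x. \<phi> \<in> borel_measurable lebesgue \<Longrightarrow>
    ennpow (M_rho \<rho> \<theta>' \<phi> x) (s - 1) \<le> ennreal K * vitali_max (density lebesgue \<omega>)
      (\<lambda>y. ennpow (vitali_max (density lebesgue \<sigma>) (\<lambda>z. ennreal (\<bar>\<phi> z\<bar> / \<sigma> z)) y) (s - 1)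
        * ennreal (1 / \<omega> y)) x"
    using M_rho_le_iterated_vitali_max[OF \<sigma>_def rho s \<theta> A] by blast
  define s' where "s' = s / (s - 1)"
  have s': "1 < s'" "(s - 1) * s' = s" using s by (simp_all add: s'_def)
  define C1 where "C1 = 2 powr s' * s' / (s' - 1)"
  define C2 where "C2 = 2 powr s * s / (s - 1)"
  have C: "0 \<le> C1" "0 \<le> C2" using s s' by (simp_all add: C1_def C2_def)
  show ?thesis
  proof (intro exI[of _ "K powr s' * (C1 * C2)"] conjI ballI)
    show "0 \<le> K powr s' * (C1 * C2)" using C by simp
  next
    fix \<phi> :: "'a \<Rightarrow> real" assume [measurable]: "\<phi> \<in> borel_measurable lebesgue"
    define Q where "Q = vitali_max (density lebesgue \<sigma>) (\<lambda>z. ennreal (\<bar>\<phi> z\<bar> / \<sigma> z))"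
    have [measurable]: "Q \<in> borel_measurable lebesgue" unfolding Q_def by measurable
    define g where "g = (\<lambda>y. ennpow (Q y) (s - 1) * ennreal (1 / \<omega> y))"
    have [measurable]: "g \<in> borel_measurable lebesgue" unfolding g_def by measurable
    define R where "R = vitali_max (density lebesgue \<omega>) g"
    have [measurable]: "R \<in> borel_measurable lebesgue" unfolding R_def by measurable
    have "(\<integral>\<^sup>+x. ennpow (M_rho \<rho> \<theta>' \<phi> x) s * ennreal (\<omega> x) \<partial>lebesgue)
        \<le> (\<integral>\<^sup>+x. ennreal (K powr s') * (ennreal (\<omega> x) * ennpow (R x) s') \<partial>lebesgue)"
    proof (intro nn_integral_mono)
      fix x
      have "ennpow (M_rho \<rho> \<theta>' \<phi> x) s = ennpow (ennpow (M_rho \<rho> \<theta>' \<phi> x) (s - 1)) s'"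
        by (simp add: ennpow_ennpow s')
      also have "\<dots> \<le> ennpow (ennreal K * R x) s'"
        using s' K(2)[of \<phi> x] by (intro ennpow_mono) (auto simp: R_def g_def Q_def)
      also have "\<dots> = ennreal (K powr s') * ennpow (R x) s'"
        using s' K(1) by (simp add: ennpow_mult ennpow_ennreal)
      finally have "ennpow (M_rho \<rho> \<theta>' \<phi> x) s * ennreal (\<omega> x)
          \<le> ennreal (K powr s') * ennpow (R x) s' * ennreal (\<omega> x)"
        by (intro mult_right_mono) auto
      then show "ennpow (M_rho \<rho> \<theta>' \<phi> x) s * ennreal (\<omega> x)
          \<le> ennreal (K powr s') * (ennreal (\<omega> x) * ennpow (R x) s')"
        by (simp add: ac_simps)
    qed
    also have "\<dots> = ennreal (K powr s') * (\<integral>\<^sup>+x. ennpow (R x) s' \<partial>density lebesgue \<omega>)"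
      by (simp add: nn_integral_cmult nn_integral_density)
    also have "\<dots> \<le> ennreal (K powr s') * (ennreal C1 * (\<integral>\<^sup>+x. ennpow (g x) s' \<partial>density lebesgue \<omega>))"
      unfolding R_def C1_def using s'
      by (intro mult_left_mono vitali_max_strong_type sigma_finite_density_lebesgue) auto
    also have "(\<integral>\<^sup>+x. ennpow (g x) s' \<partial>density lebesgue \<omega>)
        = (\<integral>\<^sup>+x. ennreal (\<omega> x) * ennpow (g x) s' \<partial>lebesgue)"
      by (rule nn_integral_density) measurable
    also have "\<dots> = (\<integral>\<^sup>+x. ennreal (\<sigma> x) * ennpow (Q x) s \<partial>lebesgue)"
    proof (rule nn_integral_cong_AE)
      show "AE x in lebesgue. ennreal (\<omega> x) * ennpow (g x) s' = ennreal (\<sigma> x) * ennpow (Q x) s"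
        using \<omega>_pos
      proof eventually_elim
        case (elim x)
        have "\<omega> x * (1 / \<omega> x) powr s' = \<omega> x powr (1 - s')"
          using elim by (simp add: powr_diff powr_divide)
        also have "1 - s' = - 1 / (s - 1)"
          using s by (simp add: s'_def field_simps)
        finally have *: "ennreal (\<omega> x) * ennreal ((1 / \<omega> x) powr s') = ennreal (\<sigma> x)"
          using elim by (simp add: \<sigma>_def flip: ennreal_mult)
        have "ennpow (g x) s' = ennpow (Q x) s * ennreal ((1 / \<omega> x) powr s')"
          using s' elim by (simp add: g_def ennpow_mult ennpow_ennpow ennpow_ennreal)
        then show ?case
          by (simp flip: *) (simp add: ac_simps)
      qed
    qed
    also have "\<dots> = (\<integral>\<^sup>+x. ennpow (Q x) s \<partial>density lebesgue \<sigma>)"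
      by (rule nn_integral_density[symmetric]) measurable
    also have "ennreal (K powr s') * (ennreal C1 * \<dots>)
        \<le> ennreal (K powr s') * (ennreal C1 * (ennreal C2 *
            (\<integral>\<^sup>+x. ennpow (ennreal (\<bar>\<phi> x\<bar> / \<sigma> x)) s \<partial>density lebesgue \<sigma>)))"
      unfolding Q_def C2_def using s
      by (intro mult_left_mono vitali_max_strong_type sigma_finite_density_lebesgue) auto
    also have "(\<integral>\<^sup>+x. ennpow (ennreal (\<bar>\<phi> x\<bar> / \<sigma> x)) s \<partial>density lebesgue \<sigma>)
        = (\<integral>\<^sup>+x. ennreal (\<sigma> x) * ennpow (ennreal (\<bar>\<phi> x\<bar> / \<sigma> x)) s \<partial>lebesgue)"
      by (rule nn_integral_density) measurable
    also have "\<dots> = (\<integral>\<^sup>+x. ennreal (\<bar>\<phi> x\<bar> powr s * \<omega> x) \<partial>lebesgue)"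
    proof (rule nn_integral_cong_AE)
      show "AE x in lebesgue. ennreal (\<sigma> x) * ennpow (ennreal (\<bar>\<phi> x\<bar> / \<sigma> x)) s
          = ennreal (\<bar>\<phi> x\<bar> powr s * \<omega> x)"
        using \<omega>_pos
      proof eventually_elim
        case (elim x)
        then have \<sigma>x: "0 < \<sigma> x" by (simp add: \<sigma>_def)
        have "- 1 / (s - 1) * (1 - s) = 1"
          using s by (simp add: field_simps)
        then have "\<sigma> x powr (1 - s) = \<omega> x"
          using elim unfolding \<sigma>_def powr_powr by simp
        then have "\<sigma> x / \<sigma> x powr s = \<omega> x"
          using \<sigma>x by (simp add: powr_diff)
        then have "\<sigma> x * (\<bar>\<phi> x\<bar> / \<sigma> x) powr s = \<bar>\<phi> x\<bar> powr s * \<omega> x"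
          using \<sigma>x by (simp add: powr_divide field_simps)
        then show ?case
          using \<sigma>x by (simp add: ennpow_ennreal flip: ennreal_mult)
      qed
    qed
    finally show "(\<integral>\<^sup>+x. ennpow (M_rho \<rho> \<theta>' \<phi> x) s * ennreal (\<omega> x) \<partial>lebesgue)
      \<le> ennreal (K powr s' * (C1 * C2)) * (\<integral>\<^sup>+x. ennreal (\<bar>\<phi> x\<bar> powr s * \<omega> x) \<partial>lebesgue)"
      using C by (simp add: ennreal_mult mult.assoc)
  qed
qed

section \<open>Ball averages\<close>

text \<open>A substitute for Lebesgue's differentiation theorem: on \<open>{G < s < t < F}\<close> a Vitali
  covering by balls of average at most \<open>s\<close> is incompatible with \<open>F > t\<close>.\<close>
lemma AE_le_of_small_ball_averages:
  fixes F G :: "'a::euclidean_space \<Rightarrow> ennreal"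
  assumes F[measurable]: "F \<in> borel_measurable lebesgue" and G[measurable]: "G \<in> borel_measurable lebesgue"
    and fin: "(\<integral>\<^sup>+x. F x \<partial>lebesgue) < \<infinity>"
    and \<delta>: "\<And>x. 0 < \<delta> x"
    and avg: "\<And>x r. 0 < r \<Longrightarrow> r < \<delta> x \<Longrightarrow> (\<integral>\<^sup>+y\<in>ball x r. F y \<partial>lebesgue) \<le> G x * emeasure lebesgue (ball x r)"
  shows "AE x in lebesgue. F x \<le> G x"
proof -
  have null: "AE x in lebesgue. \<not> (G x < ennreal s \<and> ennreal t < F x)" if st: "0 < s" "s < t" for s t
  proof -
    define S where "S = {x. G x < ennreal s \<and> ennreal t < F x}"
    have "S = {x \<in> space lebesgue. G x < ennreal s \<and> ennreal t < F x}" by (simp add: S_def)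
    also have "\<dots> \<in> sets lebesgue" by measurable
    finally have S[measurable]: "S \<in> sets lebesgue" .
    \<comment> \<open>Chebyshev's inequality; with \<open>F\<close> integrable it makes the measure
      of \<open>S\<close> finite.\<close>
    have tS: "ennreal t * emeasure lebesgue S \<le> (\<integral>\<^sup>+x\<in>S. F x \<partial>lebesgue)"
    proof -
      have "ennreal t * emeasure lebesgue S = (\<integral>\<^sup>+x. ennreal t * indicator S x \<partial>lebesgue)"
        by (simp add: nn_integral_cmult_indicator)
      also have "\<dots> \<le> (\<integral>\<^sup>+x\<in>S. F x \<partial>lebesgue)"
        by (intro nn_integral_mono) (auto simp: S_def indicator_def)
      finally show ?thesis .
    qed
    also have "(\<integral>\<^sup>+x\<in>S. F x \<partial>lebesgue) \<le> (\<integral>\<^sup>+x. F x \<partial>lebesgue)"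
      by (intro nn_integral_mono) (auto simp: indicator_def)
    finally have "ennreal t * emeasure lebesgue S < \<infinity>" using fin by simp
    then obtain m where m: "emeasure lebesgue S = ennreal m" "0 \<le> m"
      using st by (elim ennreal_mult_finiteE) auto
    \<comment> \<open>Outer regularity gives an open \<open>U\<close> around \<open>S\<close> with
      excess below \<open>e\<close>. Disjoint balls inside \<open>U\<close>, centred in
      \<open>S\<close> and of average at most \<open>s\<close>, cover almost all of
      \<open>S\<close>, so \<open>t * m\<close> is at most \<open>s\<close> times the measure of
      \<open>U\<close>.\<close>
    have bound: "t * m \<le> s * (m + e)" if e: "0 < e" for e
    proof -
      obtain U where U: "open U" "S \<subseteq> U" "U - S \<in> lmeasurable" "emeasure lebesgue (U - S) < ennreal e"
        using sets_lebesgue_outer_open[OF S e] by blast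
      have [measurable]: "U \<in> sets lebesgue" using U(1) by (intro sets_completionI_sets) auto
      define K where "K = {(x, r). x \<in> S \<and> 0 < r \<and> r < \<delta> x \<and> ball x r \<subseteq> U}"
      have cover: "\<exists>i. i \<in> K \<and> x \<in> ball (fst i) (snd i) \<and> snd i < d" if x: "x \<in> S" and d: "0 < d" for x d
      proof -
        obtain r where r: "0 < r" "ball x r \<subseteq> U"
          using U x by (meson open_contains_ball subsetD)
        define r' where "r' = min r (min (\<delta> x) d) / 2"
        have r': "0 < r'" "r' < r" "r' < \<delta> x" "r' < d" using r d \<delta>[of x] by (auto simp: r'_def)
        then have "ball x r' \<subseteq> U" using r(2) by (meson less_imp_le order_trans subset_ball)
        then show ?thesis using r' x by (intro exI[of _ "(x, r')"]) (auto simp: K_def)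
      qed
      obtain C where C: "countable C" "C \<subseteq> K"
        "pairwise (\<lambda>i j. disjnt (ball (fst i) (snd i)) (ball (fst j) (snd j))) C"
        "negligible (S - (\<Union>i\<in>C. ball (fst i) (snd i)))"
        by (rule Vitali_covering_theorem_balls[OF cover])
      let ?B = "\<lambda>i. ball (fst i) (snd i)"
      have disj: "disjoint_family_on ?B C"
        using C(3) by (auto simp: disjoint_family_on_def pairwise_def disjnt_def)
      have ball: "ball c r \<in> sets lebesgue" for c :: 'a and r by simp
      note tS
      also have "(\<integral>\<^sup>+x\<in>S. F x \<partial>lebesgue) \<le> (\<integral>\<^sup>+x\<in>\<Union>(?B ` C). F x \<partial>lebesgue)"
      proof (rule nn_integral_mono_AE)
        have "AE x in lebesgue. x \<notin> S - \<Union>(?B ` C)"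
          using C(4) by (intro AE_not_in) (simp add: negligible_iff_null_sets)
        then show "AE x in lebesgue. F x * indicator S x \<le> F x * indicator (\<Union>(?B ` C)) x"
          by eventually_elim (auto simp: indicator_def)
      qed
      also have "\<dots> = (\<integral>\<^sup>+i. (\<integral>\<^sup>+x\<in>?B i. F x \<partial>lebesgue) \<partial>count_space C)"
        using C(1) disj F ball by (intro nn_integral_count_space_disjoint[symmetric])
      also have "\<dots> \<le> (\<integral>\<^sup>+i. ennreal s * emeasure lebesgue (?B i) \<partial>count_space C)"
      proof (rule nn_integral_mono)
        fix i assume "i \<in> space (count_space C)"
        then have i: "fst i \<in> S" "0 < snd i" "snd i < \<delta> (fst i)" using C(2) by (auto simp: K_def)
        have "(\<integral>\<^sup>+x\<in>?B i. F x \<partial>lebesgue) \<le> G (fst i) * emeasure lebesgue (?B i)"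
          by (rule avg[OF i(2,3)])
        also have "\<dots> \<le> ennreal s * emeasure lebesgue (?B i)"
          using i(1) by (intro mult_right_mono) (auto simp: S_def)
        finally show "(\<integral>\<^sup>+x\<in>?B i. F x \<partial>lebesgue) \<le> ennreal s * emeasure lebesgue (?B i)" .
      qed
      also have "\<dots> = ennreal s * emeasure lebesgue (\<Union>(?B ` C))"
        using C(1) disj ball by (simp add: nn_integral_cmult emeasure_UN_countable)
      also have "\<dots> \<le> ennreal s * emeasure lebesgue U"
      proof (intro mult_left_mono emeasure_mono UN_least)
        fix i assume "i \<in> C"
        then have "i \<in> K" using C(2) by blast
        then show "?B i \<subseteq> U" by (simp add: K_def split_beta)
      qed simp_all
      also have "emeasure lebesgue U = emeasure lebesgue (S \<union> (U - S))"
        using U(2) by (simp add: Un_absorb1)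
      also have "\<dots> \<le> emeasure lebesgue S + emeasure lebesgue (U - S)"
        by (intro emeasure_subadditive) auto
      also have "\<dots> \<le> ennreal m + ennreal e"
        using U(4) m by (intro add_mono) auto
      finally have "ennreal (t * m) \<le> ennreal (s * (m + e))"
        using m st e by (simp add: mult_left_mono flip: ennreal_mult ennreal_plus)
      then show ?thesis
        using m st e by (subst (asm) ennreal_le_iff) auto
    qed
    have "m = 0"
    proof (rule ccontr)
      assume "m \<noteq> 0"
      then have "0 < m" using m by simp
      \<comment> \<open>This \<open>e\<close> makes \<open>s * e\<close> half of the gap
        \<open>(t - s) * m\<close>, contradicting \<open>bound\<close>.\<close>
      have "t * m \<le> s * (m + (t - s) * m / (2 * s))"
        using st \<open>0 < m\<close> by (intro bound) auto
      also have "\<dots> = s * m + (t - s) * m / 2"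
        using st by (simp add: field_simps)
      finally have "t * m \<le> s * m + (t - s) * m / 2" .
      moreover have "(t - s) * m = t * m - s * m" by (simp add: algebra_simps)
      moreover have "0 < (t - s) * m" using st \<open>0 < m\<close> by simp
      ultimately show False by linarith
    qed
    then have "S \<in> null_sets lebesgue" using m by (auto simp: null_sets_def)
    then show ?thesis by (rule AE_I') (auto simp: S_def)
  qed
  \<comment> \<open>Wherever \<open>G x < F x\<close>, two rationals \<open>s < t\<close> fit in
    between, and \<open>s\<close> is positive because \<open>G x\<close> is nonnegative; so
    countably many null sets suffice.\<close>
  have "AE x in lebesgue. \<forall>(s, t) \<in> {(s, t). s \<in> \<rat> \<and> t \<in> \<rat> \<and> 0 < s \<and> s < t}. \<not> (G x < ennreal s \<and> ennreal t < F x)"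
  proof (subst AE_ball_countable)
    show "countable {(s::real, t::real). s \<in> \<rat> \<and> t \<in> \<rat> \<and> 0 < s \<and> s < t}"
      by (rule countable_subset[of _ "\<rat> \<times> \<rat>"]) (auto intro: countable_rat)
  qed (use null in auto)
  then show ?thesis
  proof eventually_elim
    case (elim x)
    show ?case
    proof (rule ccontr)
      assume "\<not> F x \<le> G x"
      then have less: "G x < F x" by simp
      then obtain g where g: "G x = ennreal g" "0 \<le> g" by (cases "G x") auto
      obtain f where f: "g < f" "ennreal f \<le> F x"
      proof (cases "F x")
        case (real f)
        then show ?thesis using less g that[of f] by (simp add: ennreal_less_iff)
      next
        case top
        then show ?thesis using that[of "g + 1"] by simp
      qed
      obtain s where s: "s \<in> \<rat>" "g < s" "s < f" using Rats_dense_in_real[OF f(1)] by auto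
      obtain t where t: "t \<in> \<rat>" "s < t" "t < f" using Rats_dense_in_real[OF s(3)] by auto
      have "G x < ennreal s" using g s by (simp add: ennreal_less_iff)
      moreover have "ennreal t < F x"
        using f t s g by (intro less_le_trans[OF _ f(2)]) (simp add: ennreal_less_iff)
      ultimately show False using elim s t g by force
    qed
  qed
qed

text \<open>The supremum runs over all open balls containing \<open>x\<close>, not only those
  centred there, so superlevel sets are unions of open balls.\<close>

lemma borel_measurable_M_rho [measurable]: "M_rho \<rho> \<theta> f \<in> borel_measurable lebesgue"
proof (rule borel_measurableI_greater)
  fix t
  have "{x. t < M_rho \<rho> \<theta> f x} = (\<Union>(c, r) \<in> {(c, r). 0 < r \<and>
      t < avg_psi \<rho> \<theta> c r (\<lambda>y. ennreal \<bar>f y\<bar>)}. ball c r)"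
    unfolding M_rho_def by (auto simp: less_SUP_iff) blast
  then have "open {x. t < M_rho \<rho> \<theta> f x}"
    by auto
  then show "{x \<in> space lebesgue. t < M_rho \<rho> \<theta> f x} \<in> sets lebesgue"
    by (simp add: sets_completionI_sets)
qed

section \<open>Calculus of averages over balls\<close>

lemma avg_mono_AE:
  assumes "AE y in lebesgue. y \<in> ball c r \<longrightarrow> g y \<le> h y"
  shows "avg c r g \<le> avg c r h"
  unfolding avg_def using assms
  by (intro mult_left_mono nn_integral_mono_AE) (auto simp: indicator_def elim: eventually_mono)

lemma avg_add:
  assumes [measurable]: "g \<in> borel_measurable lebesgue" "h \<in> borel_measurable lebesgue"
  shows "avg c r (\<lambda>y. g y + h y) = avg c r g + avg c r h"
proof -
  have [measurable]: "ball c r \<in> sets lebesgue" by simp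
  have "(\<integral>\<^sup>+y\<in>ball c r. (g y + h y) \<partial>lebesgue) = (\<integral>\<^sup>+y\<in>ball c r. g y \<partial>lebesgue) + (\<integral>\<^sup>+y\<in>ball c r. h y \<partial>lebesgue)"
    by (subst nn_integral_add[symmetric]) (auto simp: distrib_right intro!: nn_integral_cong)
  then show ?thesis
    unfolding avg_def by (simp add: distrib_left)
qed

lemma avg_cmult:
  assumes [measurable]: "g \<in> borel_measurable lebesgue"
  shows "avg c r (\<lambda>y. k * g y) = k * avg c r g"
proof -
  have [measurable]: "ball c r \<in> sets lebesgue" by simp
  have "(\<integral>\<^sup>+y\<in>ball c r. (k * g y) \<partial>lebesgue) = k * (\<integral>\<^sup>+y\<in>ball c r. g y \<partial>lebesgue)"
    by (subst nn_integral_cmult[symmetric]) (auto simp: mult.assoc)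
  then show ?thesis
    unfolding avg_def by (simp add: ac_simps)
qed

lemma avg_const:
  assumes r: "0 < r"
  shows "avg c r (\<lambda>y. k) = k"
proof -
  let ?V = "measure lebesgue (ball c r)"
  have "0 < ?V" using content_ball_pos[OF r, of c] by simp
  then have "ennreal (1 / ?V) * ennreal ?V = 1"
    by (subst ennreal_mult[symmetric]) auto
  then show ?thesis
    by (simp add: avg_def nn_integral_cmult_indicator emeasure_ball_eq_measure mult.left_commute)
qed

lemma set_nn_integral_ball_eq_avg:
  assumes r: "0 < r"
  shows "(\<integral>\<^sup>+y\<in>ball c r. g y \<partial>lebesgue) = avg c r g * emeasure lebesgue (ball c r)"
proof -
  let ?V = "measure lebesgue (ball c r)"
  have "0 < ?V" using content_ball_pos[OF r, of c] by simp
  then have "ennreal ?V * ennreal (1 / ?V) = 1"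
    by (subst ennreal_mult[symmetric]) auto
  then have "(\<integral>\<^sup>+y\<in>ball c r. g y \<partial>lebesgue)
      = ennreal ?V * ennreal (1 / ?V) * (\<integral>\<^sup>+y\<in>ball c r. g y \<partial>lebesgue)"
    by simp
  then show ?thesis
    unfolding avg_def emeasure_ball_eq_measure by (simp only: ac_simps)
qed

text \<open>The factor 2 comes from splitting \<open>\<bar>g\<bar>\<close> at a height just above the \<open>q\<close>-average, which
  replaces Jensen's inequality and treats \<open>q = \<infinity>\<close> on the same footing.\<close>
lemma avg_powr_le_q_avg:
  fixes g :: "'a::euclidean_space \<Rightarrow> real" and q :: ereal
  assumes g[measurable]: "g \<in> borel_measurable lebesgue" and r: "0 < r" and p: "0 < p" "ereal p < q"
  shows "avg c r (\<lambda>y. ennreal (\<bar>g y\<bar> powr p)) \<le> 2 * ennpow (q_avg q c r g) p"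
proof (cases "q_avg q c r g")
  case top
  then show ?thesis by simp
next
  case (real \<beta>)
  \<comment> \<open>A height strictly above \<open>\<beta>\<close> is positive and, for
    \<open>q = \<infinity>\<close>, exceeds some essential bound by the definition of the
    infimum.\<close>
  have step: "avg c r (\<lambda>y. ennreal (\<bar>g y\<bar> powr p)) \<le> ennreal (2 * a powr p)" if a: "\<beta> < a" for a
  proof (cases q)
    case PInf
    have "ess_sup_ball c r g < ennreal a"
      using real a PInf by (simp add: q_avg_def ennreal_less_iff)
    then obtain b where b: "b < ennreal a" "AE y in lebesgue. y \<in> ball c r \<longrightarrow> ennreal \<bar>g y\<bar> \<le> b"
      unfolding ess_sup_ball_def by (auto simp: Inf_less_iff)
    have "avg c r (\<lambda>y. ennreal (\<bar>g y\<bar> powr p)) \<le> avg c r (\<lambda>y. ennreal (a powr p))"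
    proof (rule avg_mono_AE)
      show "AE y in lebesgue. y \<in> ball c r \<longrightarrow> ennreal (\<bar>g y\<bar> powr p) \<le> ennreal (a powr p)"
        using b(2)
      proof eventually_elim
        case (elim y)
        show ?case
        proof
          assume "y \<in> ball c r"
          then have "ennreal \<bar>g y\<bar> < ennreal a" using elim b(1) by auto
          then show "ennreal (\<bar>g y\<bar> powr p) \<le> ennreal (a powr p)"
            using p by (intro ennreal_leI powr_mono2) (auto simp: ennreal_less_iff)
        qed
      qed
    qed
    also have "\<dots> = ennreal (a powr p)" by (rule avg_const[OF r])
    also have "\<dots> \<le> ennreal (2 * a powr p)" by (intro ennreal_leI) simp
    finally show ?thesis .
  next
    case (real t)
    have t: "p < t" "0 < t" using p real by auto
    have a0: "0 < a" using a \<open>0 \<le> \<beta>\<close> by simp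
    let ?X = "avg c r (\<lambda>y. ennreal (\<bar>g y\<bar> powr t))"
    have "ennpow ?X (1 / t) = ennreal \<beta>"
      using \<open>q_avg q c r g = ennreal \<beta>\<close> real by (simp add: q_avg_def)
    then have "ennpow (ennpow ?X (1 / t)) t = ennpow (ennreal \<beta>) t" by simp
    then have X: "?X = ennreal (\<beta> powr t)"
      using t \<open>0 \<le> \<beta>\<close> by (simp add: ennpow_ennpow ennpow_ennreal)
    have "avg c r (\<lambda>y. ennreal (\<bar>g y\<bar> powr p))
        \<le> avg c r (\<lambda>y. ennreal (a powr p) + ennreal (a powr (p - t)) * ennreal (\<bar>g y\<bar> powr t))"
    proof (rule avg_mono_AE, rule AE_I2, rule impI)
      fix y
      have "\<bar>g y\<bar> powr p \<le> a powr p + a powr (p - t) * \<bar>g y\<bar> powr t"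
      proof (cases "\<bar>g y\<bar> \<le> a")
        case True
        then have "\<bar>g y\<bar> powr p \<le> a powr p" using p by (intro powr_mono2) auto
        then show ?thesis by (simp add: add_increasing2)
      next
        case False
        \<comment> \<open>The exponent \<open>p - t\<close> is negative, so above the height
          \<open>a\<close> the power is at most that of \<open>a\<close>.\<close>
        then have "\<bar>g y\<bar> powr (p - t) \<le> a powr (p - t)"
          using a0 t by (intro powr_mono2') auto
        then have "\<bar>g y\<bar> powr (p - t) * \<bar>g y\<bar> powr t \<le> a powr (p - t) * \<bar>g y\<bar> powr t"
          by (rule mult_right_mono) simp
        then have "\<bar>g y\<bar> powr p \<le> a powr (p - t) * \<bar>g y\<bar> powr t"
          using False a0 by (simp flip: powr_add)
        then show ?thesis by (simp add: add_increasing)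
      qed
      then have "ennreal (\<bar>g y\<bar> powr p) \<le> ennreal (a powr p + a powr (p - t) * \<bar>g y\<bar> powr t)"
        by (rule ennreal_leI)
      then show "ennreal (\<bar>g y\<bar> powr p) \<le> ennreal (a powr p) + ennreal (a powr (p - t)) * ennreal (\<bar>g y\<bar> powr t)"
        by (simp add: ennreal_mult)
    qed
    also have "\<dots> = ennreal (a powr p) + ennreal (a powr (p - t)) * ?X"
      by (simp add: avg_add avg_cmult avg_const[OF r])
    also have "\<dots> = ennreal (a powr p + a powr (p - t) * \<beta> powr t)"
      by (simp add: X ennreal_mult)
    also have "\<dots> \<le> ennreal (2 * a powr p)"
    proof (rule ennreal_leI)
      have "a powr (p - t) * \<beta> powr t \<le> a powr (p - t) * a powr t"
        using a t \<open>0 \<le> \<beta>\<close> by (intro mult_left_mono powr_mono2) auto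
      also have "\<dots> = a powr p" by (simp flip: powr_add)
      finally show "a powr p + a powr (p - t) * \<beta> powr t \<le> 2 * a powr p" by simp
    qed
    finally show ?thesis .
  qed (use p in auto)
  \<comment> \<open>The height decreases to \<open>\<beta>\<close>; since \<open>p > 0\<close>, the
    power is continuous even at \<open>\<beta> = 0\<close>.\<close>
  have "(\<lambda>n. ennreal (2 * (\<beta> + inverse (real (Suc n))) powr p)) \<longlonglongrightarrow> ennreal (2 * (\<beta> + 0) powr p)"
    using p \<open>0 \<le> \<beta>\<close>
    by (intro tendsto_ennrealI tendsto_mult tendsto_const tendsto_powr' tendsto_add LIMSEQ_inverse_real_of_nat)
      auto
  then have "avg c r (\<lambda>y. ennreal (\<bar>g y\<bar> powr p)) \<le> ennreal (2 * (\<beta> + 0) powr p)"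
    by (rule LIMSEQ_le_const) (auto intro!: exI[of _ 0] step)
  then show ?thesis
    using real by (simp add: ennpow_ennreal ennreal_mult)
qed

text \<open>Bounding the sum by twice the maximum treats all positive exponents alike, without
  convexity.\<close>

lemma powr_add_le:
  fixes u v p :: real
  assumes p: "0 < p" and uv: "0 \<le> u" "0 \<le> v"
  shows "(u + v) powr p \<le> 2 powr p * (u powr p + v powr p)"
proof -
  have "(u + v) powr p \<le> (2 * max u v) powr p"
    using p uv by (intro powr_mono2) auto
  also have "\<dots> = 2 powr p * max u v powr p"
    using uv by (simp add: powr_mult)
  also have "\<dots> \<le> 2 powr p * (u powr p + v powr p)"
    by (intro mult_left_mono) (auto simp: max_def)
  finally show ?thesis .
qed

text \<open>Sublinearity of \<open>T\<close> is assumed on \<open>L^p0\<close> only, so both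
  \<open>f - A r f\<close> and \<open>A r f\<close> must lie there before \<open>T\<close> may be
  applied to their sum.\<close>

lemma in_Lp_diff:
  assumes f: "in_Lp p f" and g: "in_Lp p g" and p: "0 < p"
  shows "in_Lp p (\<lambda>y. f y - g y)"
proof -
  have [measurable]: "f \<in> borel_measurable lebesgue" "g \<in> borel_measurable lebesgue"
    using f g by (auto simp: in_Lp_def)
  have "(\<integral>\<^sup>+y. ennreal (\<bar>f y - g y\<bar> powr p) \<partial>lebesgue)
      \<le> (\<integral>\<^sup>+y. ennreal (2 powr p) * (ennreal (\<bar>f y\<bar> powr p) + ennreal (\<bar>g y\<bar> powr p)) \<partial>lebesgue)"
  proof (rule nn_integral_mono)
    fix y
    have "\<bar>f y - g y\<bar> powr p \<le> (\<bar>f y\<bar> + \<bar>g y\<bar>) powr p"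
      using p by (intro powr_mono2) auto
    also have "\<dots> \<le> 2 powr p * (\<bar>f y\<bar> powr p + \<bar>g y\<bar> powr p)"
      using p by (intro powr_add_le) auto
    finally show "ennreal (\<bar>f y - g y\<bar> powr p) \<le> ennreal (2 powr p) * (ennreal (\<bar>f y\<bar> powr p) + ennreal (\<bar>g y\<bar> powr p))"
      by (simp flip: ennreal_mult ennreal_plus)
  qed
  also have "\<dots> = ennreal (2 powr p) * ((\<integral>\<^sup>+y. ennreal (\<bar>f y\<bar> powr p) \<partial>lebesgue) + (\<integral>\<^sup>+y. ennreal (\<bar>g y\<bar> powr p) \<partial>lebesgue))"
    by (simp add: nn_integral_cmult nn_integral_add)
  also have "\<dots> < \<infinity>"
    using f g by (auto simp: in_Lp_def ennreal_mult_less_top)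
  finally show ?thesis by (simp add: in_Lp_def)
qed

lemma Linf_c_imp_in_Lp:
  fixes f :: "'a::euclidean_space \<Rightarrow> real"
  assumes f: "Linf_c f" and p: "0 < p"
  shows "in_Lp p f"
proof -
  have [measurable]: "f \<in> borel_measurable lebesgue" using f by (simp add: Linf_c_def)
  obtain M R where M: "\<And>x. \<bar>f x\<bar> \<le> M" and R: "\<And>x. R < norm x \<Longrightarrow> f x = 0"
    using f by (auto simp: Linf_c_def)
  \<comment> \<open>\<open>R\<close> may be negative; with this radius every point off the open ball
    has norm strictly above \<open>R\<close>.\<close>
  have "(\<integral>\<^sup>+y. ennreal (\<bar>f y\<bar> powr p) \<partial>lebesgue) \<le> (\<integral>\<^sup>+y. ennreal (M powr p) * indicator (ball (0::'a) (\<bar>R\<bar> + 1)) y \<partial>lebesgue)"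
  proof (rule nn_integral_mono)
    fix y
    have "\<bar>f y\<bar> powr p \<le> M powr p" using p M by (intro powr_mono2) auto
    moreover have "f y = 0" if "y \<notin> ball 0 (\<bar>R\<bar> + 1)" using that by (intro R) auto
    ultimately show "ennreal (\<bar>f y\<bar> powr p) \<le> ennreal (M powr p) * indicator (ball 0 (\<bar>R\<bar> + 1)) y"
      using p by (auto simp: indicator_def intro: ennreal_leI)
  qed
  also have "\<dots> < \<infinity>"
    by (simp add: nn_integral_cmult_indicator emeasure_ball_eq_measure ennreal_mult_less_top)
  finally show ?thesis by (simp add: in_Lp_def)
qed

section \<open>Pointwise domination of the operator\<close>

theorem theorem3p2:
  fixes \<rho> :: "'a::euclidean_space \<Rightarrow> real"
    and T :: "('a \<Rightarrow> real) \<Rightarrow> ('a \<Rightarrow> real)"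
    and A :: "real \<Rightarrow> ('a \<Rightarrow> real) \<Rightarrow> ('a \<Rightarrow> real)"
    and p0 p c0 :: real and q0 :: ereal and \<omega> :: "'a \<Rightarrow> real"
  assumes rho: "critical_function \<rho>"
    and p0: "1 \<le> p0" "ereal p0 < q0"
    and T: "sublinear_bounded_Lp p0 T"
    and A: "\<And>r f. r > 0 \<Longrightarrow> Linf_c f \<Longrightarrow> in_Lp p0 (A r f)"
    and c0: "c0 \<ge> 1"
    and H: "\<And>\<theta>. \<theta> > 0 \<Longrightarrow> \<exists>C. \<forall>f. Linf_c f \<longrightarrow>
        (\<forall>x. (SUP (x0, r) \<in> {(x0, r). 0 < r \<and> r < \<rho> x0 \<and> x \<in> ball x0 r}.
                 avg x0 (c0 * r) (\<lambda>y. ennreal (\<bar>T (\<lambda>z. f z - A (c0 * r) f z) y\<bar> powr p0)))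
             + (SUP (x0, r) \<in> {(x0, r). r \<ge> \<rho> x0 \<and> x \<in> ball x0 r}.
                 avg_psi \<rho> \<theta> x0 r (\<lambda>y. ennreal (\<bar>T f y\<bar> powr p0)))
             \<le> ennreal C * M_rho \<rho> \<theta> (\<lambda>y. \<bar>f y\<bar> powr p0) x) \<and>
        (\<forall>x0 r x. 0 < r \<longrightarrow> r < \<rho> x0 \<longrightarrow> x \<in> ball x0 (c0 * r) \<longrightarrow>
             q_avg q0 x0 (c0 * r) (T (A (c0 * r) f))
               \<le> ennreal C * ennpow (M_rho \<rho> \<theta> (\<lambda>y. \<bar>f y\<bar> powr p0) x) (1 / p0))"
    and p: "p0 < p" "ereal p \<le> q0"
    and w: "A_p_rho_infty \<rho> (p / p0) \<omega>" "RH_loc \<rho> (rh_exponent q0 p) \<omega>"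
  shows "\<exists>C. \<forall>f. Linf_c f \<longrightarrow> Lp_w_norm p \<omega> (T f) \<le> ennreal C * Lp_w_norm p \<omega> f"
proof -

  \<comment> \<open>Choice of exponents and constants\<close>
  have \<rho>: "\<And>x. 0 < \<rho> x" using rho by (simp add: critical_function_def)
  have p0': "0 < p0" using p0 p by auto
  define s where "s = p / p0"
  have s: "1 < s" using p0' p by (simp add: s_def)
  obtain \<theta>0 where \<theta>0: "0 \<le> \<theta>0" "A_p_rho \<rho> \<theta>0 s \<omega>"
    using w(1) by (auto simp: A_p_rho_infty_def s_def)
  \<comment> \<open>The summand 1 makes \<open>\<theta>\<close> positive, as \<open>H\<close>
    demands, even when \<open>\<theta>0 = 0\<close>.\<close>
  define \<theta> where "\<theta> = \<theta>0 * s / (s - 1) + 1"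
  have \<theta>: "0 < \<theta>" "\<theta>0 * s / (s - 1) \<le> \<theta>"
    using divide_nonneg_pos[of "\<theta>0 * s" "s - 1"] \<theta>0(1) s by (auto simp: \<theta>_def intro: add_nonneg_pos)
  obtain K where K: "0 \<le> K" "\<And>\<phi>. \<phi> \<in> borel_measurable lebesgue \<Longrightarrow>
      (\<integral>\<^sup>+x. ennpow (M_rho \<rho> \<theta> \<phi> x) s * ennreal (\<omega> x) \<partial>lebesgue)
        \<le> ennreal K * (\<integral>\<^sup>+x. ennreal (\<bar>\<phi> x\<bar> powr s * \<omega> x) \<partial>lebesgue)"
    using M_rho_weighted_strong_type[OF \<rho> s \<theta>0(1) \<theta>(2) \<theta>0(2)] by blast
  obtain C where C: "\<And>f x. Linf_c f \<Longrightarrow>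
        (SUP (x0, r) \<in> {(x0, r). 0 < r \<and> r < \<rho> x0 \<and> x \<in> ball x0 r}.
           avg x0 (c0 * r) (\<lambda>y. ennreal (\<bar>T (\<lambda>z. f z - A (c0 * r) f z) y\<bar> powr p0)))
         + (SUP (x0, r) \<in> {(x0, r). r \<ge> \<rho> x0 \<and> x \<in> ball x0 r}.
             avg_psi \<rho> \<theta> x0 r (\<lambda>y. ennreal (\<bar>T f y\<bar> powr p0)))
         \<le> ennreal C * M_rho \<rho> \<theta> (\<lambda>y. \<bar>f y\<bar> powr p0) x"
    "\<And>f x0 r x. Linf_c f \<Longrightarrow> 0 < r \<Longrightarrow> r < \<rho> x0 \<Longrightarrow> x \<in> ball x0 (c0 * r) \<Longrightarrow>
       q_avg q0 x0 (c0 * r) (T (A (c0 * r) f))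
         \<le> ennreal C * ennpow (M_rho \<rho> \<theta> (\<lambda>y. \<bar>f y\<bar> powr p0) x) (1 / p0)"
    using H[OF \<theta>(1)] by blast
  \<comment> \<open>\<open>2 powr p0\<close> comes from \<open>powr_add_le\<close>; the two summands
    bound the averages for \<open>f - A r f\<close> and for \<open>A r f\<close>, the latter with
    the factor 2 of \<open>avg_powr_le_q_avg\<close>. Absolute values guard against a negative
    \<open>C\<close>.\<close>
  define L where "L = 2 powr p0 * (\<bar>C\<bar> + 2 * \<bar>C\<bar> powr p0)"
  have L: "0 \<le> L" by (simp add: L_def)
  have Tsub: "AE x in lebesgue. \<bar>T (\<lambda>y. f y + g y) x\<bar> \<le> \<bar>T f x\<bar> + \<bar>T g x\<bar>"
    if "in_Lp p0 f" "in_Lp p0 g" for f g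
    using T that unfolding sublinear_bounded_Lp_def by blast
  have Tmem: "in_Lp p0 (T f)" if "in_Lp p0 f" for f
    using T that unfolding sublinear_bounded_Lp_def by blast
  have Tmeas: "T f \<in> borel_measurable lebesgue" if "in_Lp p0 f" for f
    using Tmem[OF that] by (simp add: in_Lp_def)

  \<comment> \<open>Pointwise bound for the operator by the maximal function\<close>
  have main: "AE x in lebesgue. ennreal (\<bar>T f x\<bar> powr p0) \<le> ennreal L * M_rho \<rho> \<theta> (\<lambda>y. \<bar>f y\<bar> powr p0) x"
    if f: "Linf_c f" for f
  proof (rule AE_le_of_small_ball_averages)
    let ?G = "M_rho \<rho> \<theta> (\<lambda>y. \<bar>f y\<bar> powr p0)"
    have fL: "in_Lp p0 f" by (rule Linf_c_imp_in_Lp[OF f p0'])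
    note [measurable] = Tmeas[OF fL]
    show "(\<lambda>x. ennreal (\<bar>T f x\<bar> powr p0)) \<in> borel_measurable lebesgue" by measurable
    show "(\<lambda>x. ennreal L * ?G x) \<in> borel_measurable lebesgue" by measurable
    show "(\<integral>\<^sup>+x. ennreal (\<bar>T f x\<bar> powr p0) \<partial>lebesgue) < \<infinity>"
      using Tmem[OF fL] by (simp add: in_Lp_def)
    show "0 < c0 * \<rho> x" for x using \<rho>[of x] c0 by simp
    fix x r assume r: "0 < r" "r < c0 * \<rho> x"
    \<comment> \<open>The ball of radius \<open>u\<close> about \<open>x\<close> is small in the
      sense of \<open>H\<close>, and its \<open>c0\<close>-dilate is the given ball of radius
      \<open>r\<close>; hence the threshold \<open>c0 * \<rho> x\<close>.\<close>
    define u where "u = r / c0"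
    have u: "0 < u" "u < \<rho> x" "c0 * u = r" using r c0 by (auto simp: u_def field_simps)
    define a where "a = A r f"
    have a: "in_Lp p0 a" unfolding a_def by (rule A[OF r(1) f])
    have d: "in_Lp p0 (\<lambda>z. f z - a z)" by (rule in_Lp_diff[OF fL a p0'])
    note [measurable] = Tmeas[OF a] Tmeas[OF d]
    have 1: "avg x r (\<lambda>y. ennreal (\<bar>T (\<lambda>z. f z - a z) y\<bar> powr p0)) \<le> ennreal \<bar>C\<bar> * ?G x"
    proof -
      have "avg x r (\<lambda>y. ennreal (\<bar>T (\<lambda>z. f z - a z) y\<bar> powr p0))
          \<le> (SUP (x0, r) \<in> {(x0, r). 0 < r \<and> r < \<rho> x0 \<and> x \<in> ball x0 r}.
           avg x0 (c0 * r) (\<lambda>y. ennreal (\<bar>T (\<lambda>z. f z - A (c0 * r) f z) y\<bar> powr p0)))"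
        by (rule SUP_upper2[where i="(x, u)"]) (use u in \<open>auto simp: a_def\<close>)
      also have "\<dots> \<le> ennreal C * ?G x"
        by (rule order_trans[OF _ C(1)[OF f]]) (simp add: add_increasing2)
      also have "\<dots> \<le> ennreal \<bar>C\<bar> * ?G x"
        by (intro mult_right_mono ennreal_leI) auto
      finally show ?thesis .
    qed
    have 2: "avg x r (\<lambda>y. ennreal (\<bar>T a y\<bar> powr p0)) \<le> ennreal (2 * \<bar>C\<bar> powr p0) * ?G x"
    proof -
      \<comment> \<open>The second part of \<open>H\<close>, evaluated at the centre
        \<open>x\<close> of the ball.\<close>
      have "q_avg q0 x r (T a) \<le> ennreal C * ennpow (?G x) (1 / p0)"
        using C(2)[OF f u(1,2), of x] u r by (simp add: a_def)
      also have "\<dots> \<le> ennreal \<bar>C\<bar> * ennpow (?G x) (1 / p0)"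
        by (intro mult_right_mono ennreal_leI) auto
      finally have "ennpow (q_avg q0 x r (T a)) p0 \<le> ennpow (ennreal \<bar>C\<bar> * ennpow (?G x) (1 / p0)) p0"
        using p0' by (intro ennpow_mono) auto
      also have "\<dots> = ennreal (\<bar>C\<bar> powr p0) * ?G x"
        using p0' by (simp add: ennpow_mult ennpow_ennpow ennpow_ennreal)
      finally have "2 * ennpow (q_avg q0 x r (T a)) p0 \<le> 2 * (ennreal (\<bar>C\<bar> powr p0) * ?G x)"
        by (intro mult_left_mono) auto
      with avg_powr_le_q_avg[OF Tmeas[OF a] r(1) p0' p0(2), of x]
      show ?thesis by (simp add: ennreal_mult mult.assoc)
    qed
    have "avg x r (\<lambda>y. ennreal (\<bar>T f y\<bar> powr p0))
        \<le> avg x r (\<lambda>y. ennreal (2 powr p0) * (ennreal (\<bar>T (\<lambda>z. f z - a z) y\<bar> powr p0) + ennreal (\<bar>T a y\<bar> powr p0)))"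
    proof (rule avg_mono_AE)
      show "AE y in lebesgue. y \<in> ball x r \<longrightarrow> ennreal (\<bar>T f y\<bar> powr p0)
          \<le> ennreal (2 powr p0) * (ennreal (\<bar>T (\<lambda>z. f z - a z) y\<bar> powr p0) + ennreal (\<bar>T a y\<bar> powr p0))"
        using Tsub[OF d a]
      proof eventually_elim
        case (elim y)
        have "\<bar>T f y\<bar> powr p0 \<le> (\<bar>T (\<lambda>z. f z - a z) y\<bar> + \<bar>T a y\<bar>) powr p0"
          using elim p0' by (intro powr_mono2) auto
        also have "\<dots> \<le> 2 powr p0 * (\<bar>T (\<lambda>z. f z - a z) y\<bar> powr p0 + \<bar>T a y\<bar> powr p0)"
          using p0' by (intro powr_add_le) auto
        finally show ?case by (simp flip: ennreal_mult ennreal_plus)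
      qed
    qed
    also have "\<dots> = ennreal (2 powr p0) * (avg x r (\<lambda>y. ennreal (\<bar>T (\<lambda>z. f z - a z) y\<bar> powr p0))
        + avg x r (\<lambda>y. ennreal (\<bar>T a y\<bar> powr p0)))"
      by (simp add: avg_cmult avg_add)
    also have "\<dots> \<le> ennreal (2 powr p0) * (ennreal \<bar>C\<bar> * ?G x + ennreal (2 * \<bar>C\<bar> powr p0) * ?G x)"
      by (intro mult_left_mono add_mono 1 2) auto
    also have "\<dots> = ennreal L * ?G x"
      by (simp add: L_def ennreal_mult mult.assoc distrib_right)
    finally show "(\<integral>\<^sup>+y\<in>ball x r. ennreal (\<bar>T f y\<bar> powr p0) \<partial>lebesgue)
        \<le> ennreal L * ?G x * emeasure lebesgue (ball x r)"
      unfolding set_nn_integral_ball_eq_avg[OF r(1)] by (rule mult_right_mono) simp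
  qed

  \<comment> \<open>Integration of the pointwise bound against the weight\<close>
  show ?thesis
  proof (intro exI allI impI)
    fix f :: "'a \<Rightarrow> real" assume f: "Linf_c f"
    have [measurable]: "f \<in> borel_measurable lebesgue" using f by (simp add: Linf_c_def)
    have \<omega>[measurable]: "\<omega> \<in> borel_measurable lebesgue"
      using \<theta>0(2) by (auto simp: A_p_rho_def weight_def)
    have ps: "p0 * s = p" "0 < s" using p0' p by (simp_all add: s_def)
    let ?G = "M_rho \<rho> \<theta> (\<lambda>y. \<bar>f y\<bar> powr p0)"
    have "(\<integral>\<^sup>+x. ennreal (\<bar>T f x\<bar> powr p * \<omega> x) \<partial>lebesgue)
        \<le> (\<integral>\<^sup>+x. ennreal (L powr s) * (ennpow (?G x) s * ennreal (\<omega> x)) \<partial>lebesgue)"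
    proof (rule nn_integral_mono_AE)
      show "AE x in lebesgue. ennreal (\<bar>T f x\<bar> powr p * \<omega> x) \<le> ennreal (L powr s) * (ennpow (?G x) s * ennreal (\<omega> x))"
        using main[OF f]
      proof eventually_elim
        case (elim x)
        have "ennreal (\<bar>T f x\<bar> powr p) = ennpow (ennreal (\<bar>T f x\<bar> powr p0)) s"
          by (simp add: ennpow_ennreal powr_powr ps)
        also have "\<dots> \<le> ennpow (ennreal L * ?G x) s"
          using ps by (intro ennpow_mono elim) auto
        also have "\<dots> = ennreal (L powr s) * ennpow (?G x) s"
          using ps L by (simp add: ennpow_mult ennpow_ennreal)
        finally have "ennreal (\<bar>T f x\<bar> powr p) * ennreal (\<omega> x) \<le> ennreal (L powr s) * ennpow (?G x) s * ennreal (\<omega> x)"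
          by (intro mult_right_mono) auto
        then show ?case by (simp add: ennreal_mult' mult.assoc)
      qed
    qed
    also have "\<dots> = ennreal (L powr s) * (\<integral>\<^sup>+x. ennpow (?G x) s * ennreal (\<omega> x) \<partial>lebesgue)"
      by (simp add: nn_integral_cmult)
    \<comment> \<open>The weighted maximal inequality is applied to
      \<open>\<bar>f\<bar> powr p0\<close>, whose power \<open>s\<close> is
      \<open>\<bar>f\<bar> powr p\<close>.\<close>
    also have "\<dots> \<le> ennreal (L powr s) * (ennreal K * (\<integral>\<^sup>+x. ennreal (\<bar>\<bar>f x\<bar> powr p0\<bar> powr s * \<omega> x) \<partial>lebesgue))"
      by (intro mult_left_mono K(2)) auto
    also have "\<dots> = ennreal (L powr s * K) * (\<integral>\<^sup>+x. ennreal (\<bar>f x\<bar> powr p * \<omega> x) \<partial>lebesgue)"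
      using K(1) by (simp add: powr_powr ps ennreal_mult mult.assoc)
    finally have "Lp_w_norm p \<omega> (T f)
        \<le> ennpow (ennreal (L powr s * K) * (\<integral>\<^sup>+x. ennreal (\<bar>f x\<bar> powr p * \<omega> x) \<partial>lebesgue)) (1 / p)"
      unfolding Lp_w_norm_def using p p0' by (intro ennpow_mono) auto
    also have "\<dots> = ennreal ((L powr s * K) powr (1 / p)) * Lp_w_norm p \<omega> f"
      unfolding Lp_w_norm_def using p p0' K(1) by (simp add: ennpow_mult ennpow_ennreal)
    finally show "Lp_w_norm p \<omega> (T f) \<le> ennreal ((L powr s * K) powr (1 / p)) * Lp_w_norm p \<omega> f" .
  qed
qed

end
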